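(* Let $L\in\{1,\infty\}$, $0<p,r\le\infty$, $b\in SV(0,L)$ be such that the Lorentz–Karamata space $L_{p,r;b}=L_{p,r;b}(0,L)$ is non-trivial (i.e. $\neq\{0\}$). Let $d\in SV(0,L)$, $0<U<\infty$, $0<V\le\infty$, $0<W\le\infty$. (i) If $0<U<p\le\infty$, then for all $f\in\mathfrak M(0,L)$ $$\|f\|_{p,r;b}\sim\big\|H^{(U,W;d)}f\big\|_{B_{p,r;b}} .$$ Moreover, $\|H^{(U,W;d)}f\|_{B_{p,r;b}}$ is an equivalent r.i. quasi-norm on $L_{p,r;b}$. (ii) If $p<V\le\infty$, then for all $f\in\mathfrak M(0,L)$ $$\|f\|_{p,r;b}\sim\big\|H_{(V,W;d)}f\big\|_{B_{p,r;b}} .$$ Moreover, $\|H_{(V,W;d)}f\|_{B_{p,r;b}}$ is an equivalent r.i. quasi-norm on $L_{p,r;b}$.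
   Context: Conventions: $1/\infty=0$. $\mathfrak M(0,L)$ is the set of complex-valued Lebesgue measurable a.e. finite functions on $(0,L)$ (identified if equal a.e.), $\mathfrak M^+(0,L)$ its subset of non-negative functions. For $0<q\le\infty$, $\|\cdot\|_{q,(a,b)}$ is the usual Lebesgue (quasi-)norm on $(a,b)$ (essential supremum if $q=\infty$). $f^*(t)=\inf\{\lambda>0:\ |\{x\in(0,L):|f(x)|>\lambda\}|\le t\}$ is the non-increasing rearrangement. $F\sim G$ means $c\,G\le F\le C\,G$ with constants $0<c\le C<\infty$ independent of $f$ (both sides may be $\infty$). $SV=SV(0,L)$: positive measurable $d$ on $(0,L)$ such that for every $\varepsilon>0$ the function $t^{\varepsilon}d(t)$ is equivalent ($\sim$, pointwise with constants) to a non-decreasing function and $t^{-\varepsilon}d(t)$ is equivalent to a non-increasing function. $\|g\|_{B_{p,r;b}}=\big\|t^{\frac1p-\frac1r}b(t)|g(t)|\big\|_{r,(0,L)}$ for measurable $g$ on $(0,L)$ (possibly with value $\infty$), and $L_{p,r;b}$ is the set of $f\in\mathfrak M(0,L)$ with $\|f\|_{p,r;b}:=\|f^*\|_{B_{p,r;b}}<\infty$. (It is known that $L_{p,r;b}\ne\{0\}$ iff $p<\infty$, or $p=\infty$ and $\|t^{-1/r}b(t)\|_{r,(0,1)}<\infty$.) Averaging operators, for $f\in\mathfrak M(0,L)$, $t\in(0,L)$: $$(H^{(U,W;d)}f)(t)=\big(t^{1/U}d(t)\big)^{-1}\big\|v^{\frac1U-\frac1W}d(v)f^*(v)\big\|_{W,(0,t)},$$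 $$(H_{(V,W;d)}f)(t)=\big(t^{1/V}d(t)\big)^{-1}\big\|v^{\frac1V-\frac1W}d(v)f^*(v)\big\|_{W,(t,L)}.$$ A functional $N$ is an equivalent r.i. quasi-norm on $L_{p,r;b}$ if $N(f)\sim\|f\|_{p,r;b}$ for all $f\in\mathfrak M(0,L)$, $N(f)=N(f^* )$, and for some $C\ge1$ and all $f,g,f_n\in\mathfrak M^+(0,L)$, $\lambda\ge0$: $N(f)=0\Leftrightarrow f=0$ a.e.; $N(\lambda f)=\lambda N(f)$; $N(f+g)\le C(N(f)+N(g))$; $g\le f$ a.e. implies $N(g)\le N(f)$; $0\le f_n\nearrow f$ a.e. and $\sup_nN(f_n)<\infty$ imply $N(f)<\infty$ and $N(f_n)\nearrow N(f)$; $N(\chi_\omega)<\infty$ for every bounded measurable $\omega\subset(0,L)$. *)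

theory Defs
  imports "HOL-Analysis.Analysis" "HOL-Probability.Essential_Supremum"
begin

text \<open>
  Functions on \<open>(0,L)\<close> are total functions on \<^typ>\<open>real\<close>; only their restrictions
  to \<^term>\<open>einterval 0 L\<close> matter.  Exponents are extended reals, and \<open>rcp p\<close> is \<open>1/p\<close>
  with \<open>1/\<infinity> = 0\<close>.  Norms take values in \<^typ>\<open>ennreal\<close>.
\<close>

definition rcp :: "ereal \<Rightarrow> real" where
  "rcp p = real_of_ereal (1 / p)"

text \<open>Only used with \<open>a > 0\<close>, so that \<open>0\<close> is mapped to \<open>0\<close> and \<open>\<infinity>\<close> to \<open>\<infinity>\<close>.\<close>

definition ennpowr :: "ennreal \<Rightarrow> real \<Rightarrow> ennreal" where
  "ennpowr x a = (if x = \<infinity> then \<infinity> else ennreal (enn2real x powr a))"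

definition Lnorm :: "ereal \<Rightarrow> real set \<Rightarrow> (real \<Rightarrow> ennreal) \<Rightarrow> ennreal" where
  "Lnorm q A g =
     (if q = \<infinity> then esssup (lebesgue_on A) g
      else ennpowr (\<integral>\<^sup>+ x. ennpowr (g x) (real_of_ereal q) \<partial>lebesgue_on A) (rcp q))"

definition sim_on :: "'a set \<Rightarrow> ('a \<Rightarrow> ennreal) \<Rightarrow> ('a \<Rightarrow> ennreal) \<Rightarrow> bool" where
  "sim_on S F G \<longleftrightarrow>
     (\<exists>c C :: real. 0 < c \<and> c \<le> C \<and>
        (\<forall>x\<in>S. ennreal c * G x \<le> F x \<and> F x \<le> ennreal C * G x))"

definition meas_fun :: "ereal \<Rightarrow> (real \<Rightarrow> complex) set" where
  "meas_fun L = borel_measurable (lebesgue_on (einterval 0 L))"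

definition meas_fun_nonneg :: "ereal \<Rightarrow> (real \<Rightarrow> complex) set" where
  "meas_fun_nonneg L =
     {f \<in> meas_fun L. AE x in lebesgue_on (einterval 0 L). f x \<in> \<real>\<^sub>\<ge>\<^sub>0}"

text \<open>The value is \<open>\<infinity>\<close> if no admissible \<open>\<lambda>\<close> exists.\<close>

definition rearr :: "ereal \<Rightarrow> (real \<Rightarrow> complex) \<Rightarrow> real \<Rightarrow> ennreal" where
  "rearr L f t =
     (INF l \<in> {l::real. 0 < l \<and>
        emeasure lebesgue {x \<in> einterval 0 L. l < cmod (f x)} \<le> ennreal t}. ennreal l)"

definition slowly_varying :: "ereal \<Rightarrow> (real \<Rightarrow> real) set" where
  "slowly_varying L =
     {d \<in> borel_measurable (lebesgue_on (einterval 0 L)).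
        (\<forall>t\<in>einterval 0 L. 0 < d t) \<and>
        (\<forall>\<epsilon>>0.
          (\<exists>\<phi> :: real \<Rightarrow> real. mono_on (einterval 0 L) \<phi> \<and>
             sim_on (einterval 0 L) (\<lambda>t. ennreal (t powr \<epsilon> * d t)) (\<lambda>t. ennreal (\<phi> t))) \<and>
          (\<exists>\<psi> :: real \<Rightarrow> real. antimono_on (einterval 0 L) \<psi> \<and>
             sim_on (einterval 0 L) (\<lambda>t. ennreal (t powr (- \<epsilon>) * d t)) (\<lambda>t. ennreal (\<psi> t))))}"

definition Bnorm ::
  "ereal \<Rightarrow> ereal \<Rightarrow> ereal \<Rightarrow> (real \<Rightarrow> real) \<Rightarrow> (real \<Rightarrow> ennreal) \<Rightarrow> ennreal" where
  "Bnorm L p r b g =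
     Lnorm r (einterval 0 L) (\<lambda>t. ennreal (t powr (rcp p - rcp r) * b t) * g t)"

definition LKnorm ::
  "ereal \<Rightarrow> ereal \<Rightarrow> ereal \<Rightarrow> (real \<Rightarrow> real) \<Rightarrow> (real \<Rightarrow> complex) \<Rightarrow> ennreal" where
  "LKnorm L p r b f = Bnorm L p r b (rearr L f)"

definition LKspace ::
  "ereal \<Rightarrow> ereal \<Rightarrow> ereal \<Rightarrow> (real \<Rightarrow> real) \<Rightarrow> (real \<Rightarrow> complex) set" where
  "LKspace L p r b = {f \<in> meas_fun L. LKnorm L p r b f < \<infinity>}"

definition LK_nontrivial :: "ereal \<Rightarrow> ereal \<Rightarrow> ereal \<Rightarrow> (real \<Rightarrow> real) \<Rightarrow> bool" where
  "LK_nontrivial L p r b \<longleftrightarrow>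
     (\<exists>f\<in>LKspace L p r b. \<not> (AE x in lebesgue_on (einterval 0 L). f x = 0))"

text \<open>\<open>avg_head\<close> is \<open>H\<^sup>(\<^sup>U\<^sup>,\<^sup>W\<^sup>;\<^sup>d\<^sup>)\<close> and \<open>avg_tail\<close> is \<open>H\<^sub>(\<^sub>V\<^sub>,\<^sub>W\<^sub>;\<^sub>d\<^sub>)\<close>.\<close>

definition avg_head ::
  "ereal \<Rightarrow> ereal \<Rightarrow> ereal \<Rightarrow> (real \<Rightarrow> real) \<Rightarrow> (real \<Rightarrow> complex) \<Rightarrow> real \<Rightarrow> ennreal" where
  "avg_head L U W d f t =
     ennreal (inverse (t powr rcp U * d t)) *
     Lnorm W (einterval 0 (ereal t))
       (\<lambda>v. ennreal (v powr (rcp U - rcp W) * d v) * rearr L f v)"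

definition avg_tail ::
  "ereal \<Rightarrow> ereal \<Rightarrow> ereal \<Rightarrow> (real \<Rightarrow> real) \<Rightarrow> (real \<Rightarrow> complex) \<Rightarrow> real \<Rightarrow> ennreal" where
  "avg_tail L V W d f t =
     ennreal (inverse (t powr rcp V * d t)) *
     Lnorm W (einterval (ereal t) L)
       (\<lambda>v. ennreal (v powr (rcp V - rcp W) * d v) * rearr L f v)"

text \<open>
  A functional on \<open>meas_fun L\<close> evaluated at a \<open>[0,\<infinity>]\<close>-valued function \<open>g\<close>: if \<open>g\<close> is not
  a.e. finite, the value is \<open>\<infinity>\<close>.  This is needed because \<open>rearr L f\<close> may be identically
  \<open>\<infinity>\<close> for a finite-valued \<open>f\<close> when \<open>L = \<infinity>\<close>.
\<close>

definition apply_ext ::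
  "ereal \<Rightarrow> ((real \<Rightarrow> complex) \<Rightarrow> ennreal) \<Rightarrow> (real \<Rightarrow> ennreal) \<Rightarrow> ennreal" where
  "apply_ext L N g =
     (if AE t in lebesgue_on (einterval 0 L). g t < \<infinity>
      then N (\<lambda>t. complex_of_real (enn2real (g t))) else \<infinity>)"

definition equiv_ri_quasinorm ::
  "ereal \<Rightarrow> ereal \<Rightarrow> ereal \<Rightarrow> (real \<Rightarrow> real) \<Rightarrow> ((real \<Rightarrow> complex) \<Rightarrow> ennreal) \<Rightarrow> bool" where
  "equiv_ri_quasinorm L p r b N \<longleftrightarrow>
     sim_on (meas_fun L) N (LKnorm L p r b) \<and>
     (\<forall>f\<in>meas_fun L. N f = apply_ext L N (rearr L f)) \<and>
     (\<forall>f\<in>meas_fun_nonneg L.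
        N f = 0 \<longleftrightarrow> (AE x in lebesgue_on (einterval 0 L). f x = 0)) \<and>
     (\<forall>f\<in>meas_fun_nonneg L. \<forall>l\<ge>0.
        N (\<lambda>x. complex_of_real l * f x) = ennreal l * N f) \<and>
     (\<exists>C::real. 1 \<le> C \<and> (\<forall>f\<in>meas_fun_nonneg L. \<forall>g\<in>meas_fun_nonneg L.
        N (\<lambda>x. f x + g x) \<le> ennreal C * (N f + N g))) \<and>
     (\<forall>f\<in>meas_fun_nonneg L. \<forall>g\<in>meas_fun_nonneg L.
        (AE x in lebesgue_on (einterval 0 L). Re (g x) \<le> Re (f x)) \<longrightarrow> N g \<le> N f) \<and>
     (\<forall>F f. (\<forall>n::nat. F n \<in> meas_fun_nonneg L) \<longrightarrow> f \<in> meas_fun_nonneg L \<longrightarrow>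
        (AE x in lebesgue_on (einterval 0 L).
           incseq (\<lambda>n. Re (F n x)) \<and> (\<lambda>n. F n x) \<longlonglongrightarrow> f x) \<longrightarrow>
        (SUP n. N (F n)) < \<infinity> \<longrightarrow>
        N f < \<infinity> \<and> incseq (\<lambda>n. N (F n)) \<and> (\<lambda>n. N (F n)) \<longlonglongrightarrow> N f) \<and>
     (\<forall>\<omega>\<in>sets lebesgue. bounded \<omega> \<longrightarrow> \<omega> \<subseteq> einterval 0 L \<longrightarrow>
        N (indicator \<omega>) < \<infinity>)"

end

theory Submission
  imports Defs
begin

text \<open>
  All estimates are made for an arbitrary non-increasing \<open>g\<close> in place of the rearrangement.
  Since \<open>b\<close> and \<open>d\<close> are slowly varying and the power weights of the outer and the inner norm
  differ by a factor \<open>(v/t)\<^bsup>\<plusminus>4\<epsilon>\<^esup>\<close>, the weighted average at \<open>t\<close> is bounded by the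
  \<open>L\<^sub>W(dv/v)\<close>-norm of \<open>k(t,v)\<^bsup>2\<epsilon>\<^esup> h(v)\<close>, where \<open>k(t,v) = min (t/v) (v/t)\<close> and
  \<open>h(v) = v\<^bsup>1/p\<^esup> b(v) g(v)\<close>.  One factor \<open>k\<^bsup>\<epsilon>\<^esup>\<close> makes the \<open>L\<^sub>W\<close>-norm finite, which
  leaves the supremum of \<open>k(t,v)\<^bsup>\<epsilon>\<^esup> h(v)\<close>; by monotonicity of \<open>g\<close> on \<open>(v/2,v)\<close> this is
  bounded by the \<open>L\<^sub>r(dv/v)\<close>-norm of the same function, and Fubini's theorem gives the upper bound.
  This avoids Hardy inequalities and any case distinction between \<open>r\<close> and \<open>W\<close>.
  For the lower bound, the interval \<open>(t/4,t/2)\<close> or \<open>(t/2,t)\<close> alone contributes at least a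
  multiple of \<open>g(t)\<close> to the average at \<open>t/2\<close>, and dilations are bounded.
  The quasi-norm axioms then follow from \<open>\<lambda> < f\<^sup>*(t) \<longleftrightarrow> t < |{|f| > \<lambda>}|\<close>.
\<close>

section \<open>Powers and Lebesgue quasi-norms with values in \<open>[0,\<infinity>]\<close>\<close>

text \<open>The exponents \<open>r\<close> and \<open>W\<close> are unrelated and may lie below 1,
  so neither Minkowski's inequality nor duality is at hand. Once inner and outer exponent agree,
  raising to that power makes the estimate linear, and an exchange of integrals suffices for every
  positive exponent. On the multiplicative half-line with \<open>dv/v\<close> the kernel is a
  convolution kernel and all intervals \<open>(v/2, v)\<close> have the same mass, so every constant
  is uniform in the point and in \<open>g\<close>; this is why a factor
  \<open>v powr (- rcp q)\<close> is split off throughout. All estimates are kept in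
  \<open>[0,\<infinity>]\<close>, because a rearrangement may be infinite and an average may
  diverge; no integrability has to be settled beforehand.\<close>

lemma ennpowr_0 [simp]: "ennpowr 0 a = 0"
  by (simp add: ennpowr_def)

lemma ennpowr_top [simp]: "ennpowr \<infinity> a = \<infinity>" "ennpowr top a = top"
  by (simp_all add: ennpowr_def)

lemma ennpowr_ennreal: "0 \<le> x \<Longrightarrow> ennpowr (ennreal x) a = ennreal (x powr a)"
  by (simp add: ennpowr_def)

lemma ennpowr_mono: "0 \<le> a \<Longrightarrow> x \<le> y \<Longrightarrow> ennpowr x a \<le> ennpowr y a"
  by (cases x; cases y) (auto simp: ennpowr_ennreal top_unique powr_mono2 intro!: ennreal_leI)

lemma ennpowr_1 [simp]: "ennpowr x 1 = x"
  by (cases x) (auto simp: ennpowr_ennreal)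

lemma ennpowr_ennpowr: "ennpowr (ennpowr x a) c = ennpowr x (a * c)"
  by (cases x) (auto simp: ennpowr_ennreal powr_powr)

text \<open>The case to check is a product with \<open>top\<close>: if the other factor is
  \<open>0\<close>, both sides vanish because \<open>0 powr a = 0\<close> for every real
  \<open>a\<close>; otherwise both are \<open>top\<close>.\<close>

lemma ennpowr_mult: "ennpowr (x * y) a = ennpowr x a * ennpowr y a"
proof -
  have *: "ennpowr (ennreal u * top) a = ennreal (u powr a) * top" if "0 \<le> u" for u
    using that by (cases "u = 0") (auto simp: ennreal_mult_top)
  show ?thesis
    using *[of "enn2real x"] *[of "enn2real y"]
    by (cases x; cases y)
       (auto simp: ennpowr_ennreal powr_mult mult.commute simp flip: ennreal_mult)
qed

lemma ennpowr_eq_0_iff [simp]: "ennpowr x a = 0 \<longleftrightarrow> x = 0"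
  by (cases x) (auto simp: ennpowr_ennreal ennreal_eq_0_iff)

lemma ennpowr_eq_top_iff [simp]: "ennpowr x a = top \<longleftrightarrow> x = top"
  by (cases x) (auto simp: ennpowr_ennreal)

text \<open>An order isomorphism of \<open>[0,\<infinity>]\<close> with inverse exponent
  \<open>1 / a\<close>, put as an adjunction because this form yields commutation with
  suprema.\<close>

lemma ennpowr_le_iff: "0 < a \<Longrightarrow> ennpowr x a \<le> y \<longleftrightarrow> x \<le> ennpowr y (1 / a)"
  using ennpowr_mono[of "1 / a" "ennpowr x a" y] ennpowr_mono[of a x "ennpowr y (1 / a)"]
  by (auto simp: ennpowr_ennpowr)

lemma ennpowr_SUP: "0 < a \<Longrightarrow> ennpowr (SUP i\<in>J. X i) a = (SUP i\<in>J. ennpowr (X i) a)"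
proof (rule order.antisym)
  assume a: "0 < a"
  have "X i \<le> ennpowr (SUP i\<in>J. ennpowr (X i) a) (1 / a)" if "i \<in> J" for i
    using that a by (subst ennpowr_le_iff[symmetric]) (auto intro: SUP_upper)
  then show "ennpowr (SUP i\<in>J. X i) a \<le> (SUP i\<in>J. ennpowr (X i) a)"
    using a by (auto simp: ennpowr_le_iff intro: SUP_least)
  show "(SUP i\<in>J. ennpowr (X i) a) \<le> ennpowr (SUP i\<in>J. X i) a"
    using a by (auto intro!: SUP_least ennpowr_mono SUP_upper)
qed

text \<open>Comparing the sum with twice the maximum gives one constant for the convex range
  \<open>a \<ge> 1\<close> and the concave range \<open>a < 1\<close>.\<close>

lemma ennpowr_add_le:
  assumes "0 < a"
  shows "ennpowr (x + y) a \<le> ennreal (2 powr a) * (ennpowr x a + ennpowr y a)"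
proof -
  have "x + y \<le> ennreal 2 * max x y"
    using add_mono[of x "max x y" y "max x y"] by (simp add: mult_2)
  then have "ennpowr (x + y) a \<le> ennpowr (ennreal 2 * max x y) a"
    using assms by (intro ennpowr_mono) auto
  also have "\<dots> = ennreal (2 powr a) * ennpowr (max x y) a"
    using ennpowr_ennreal[of 2 a] by (simp add: ennpowr_mult)
  also have "\<dots> \<le> ennreal (2 powr a) * (ennpowr x a + ennpowr y a)"
    by (intro mult_left_mono) (auto simp: max_def add_increasing add_increasing2)
  finally show ?thesis .
qed

lemma borel_measurable_ennpowr [measurable (raw)]:
  assumes [measurable]: "g \<in> borel_measurable M"
  shows "(\<lambda>x. ennpowr (g x) a) \<in> borel_measurable M"
  unfolding ennpowr_def by measurable

lemma rcp_infinity [simp]: "rcp \<infinity> = 0"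
  by (simp add: rcp_def)

lemma rcp_ereal [simp]: "0 < Q \<Longrightarrow> rcp (ereal Q) = 1 / Q"
  by (simp add: rcp_def one_ereal_def)

lemma rcp_less: "0 < q \<Longrightarrow> q < q' \<Longrightarrow> rcp q' < rcp q"
  by (cases q; cases q') (auto simp: frac_less2)

section \<open>Lebesgue quasi-norms with exponent in \<open>(0,\<infinity>]\<close>\<close>

lemma Lnorm_infinity: "Lnorm \<infinity> A g = esssup (lebesgue_on A) g"
  by (simp add: Lnorm_def)

lemma Lnorm_ereal:
  "0 < Q \<Longrightarrow> Lnorm (ereal Q) A g = ennpowr (\<integral>\<^sup>+ x. ennpowr (g x) Q \<partial>lebesgue_on A) (1 / Q)"
  by (simp add: Lnorm_def)

lemma Lnorm_cases [consumes 1, case_names infinity ereal]: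
  assumes "0 < (q::ereal)"
  obtains "q = \<infinity>" | Q where "q = ereal Q" "0 < Q"
  using assms by (cases q) auto

text \<open>Measurability is asked of the smaller function only: a non-measurable majorant has
  \<open>esssup\<close> equal to \<open>top\<close>, and the integral is monotone as it
  stands.\<close>

lemma Lnorm_mono_AE:
  assumes "0 < q" "g \<in> borel_measurable (lebesgue_on A)" "AE x in lebesgue_on A. g x \<le> h x"
  shows "Lnorm q A g \<le> Lnorm q A h"
  using assms(1)
proof (cases q rule: Lnorm_cases)
  case infinity
  then show ?thesis using assms by (auto simp: Lnorm_infinity intro: esssup_AE_mono)
next
  case (ereal Q)
  then show ?thesis using assms(3)
    by (auto simp: Lnorm_ereal intro!: ennpowr_mono nn_integral_mono_AE elim!: eventually_mono)
qed

lemma Lnorm_mono: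
  assumes "0 < q" "g \<in> borel_measurable (lebesgue_on A)" "\<And>x. x \<in> A \<Longrightarrow> g x \<le> h x"
  shows "Lnorm q A g \<le> Lnorm q A h"
  using assms by (intro Lnorm_mono_AE AE_I2) auto

lemma Lnorm_cong:
  assumes "0 < q" "\<And>x. x \<in> A \<Longrightarrow> g x = h x"
  shows "Lnorm q A g = Lnorm q A h"
  using assms(1)
proof (cases q rule: Lnorm_cases)
  case infinity
  have "g \<in> borel_measurable (lebesgue_on A) \<longleftrightarrow> h \<in> borel_measurable (lebesgue_on A)"
    using assms by (intro measurable_cong) auto
  then show ?thesis using assms infinity
    by (auto simp: Lnorm_infinity esssup_def intro!: Limsup_eq AE_I2)
next
  case (ereal Q)
  then show ?thesis using assms
    by (auto simp: Lnorm_ereal intro!: arg_cong2[where f=ennpowr] nn_integral_cong)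
qed

text \<open>Here \<open>c\<close> ranges over all of \<open>[0,\<infinity>]\<close>. The infinite
  value matters later, when the constant is itself a norm.\<close>

lemma Lnorm_cmult_le:
  assumes "0 < q" "g \<in> borel_measurable (lebesgue_on A)"
  shows "Lnorm q A (\<lambda>x. c * g x) \<le> c * Lnorm q A g"
  using assms(1)
proof (cases q rule: Lnorm_cases)
  case infinity
  have "AE x in lebesgue_on A. c * g x \<le> c * esssup (lebesgue_on A) g"
    using esssup_AE[of g "lebesgue_on A"] by (auto elim!: eventually_mono intro: mult_left_mono)
  then show ?thesis using assms infinity by (auto simp: Lnorm_infinity)
next
  case (ereal Q)
  then show ?thesis using assms
    by (simp add: Lnorm_ereal ennpowr_mult nn_integral_cmult ennpowr_ennpowr)
qed

lemma Lnorm_cmult: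
  assumes "0 < q" "g \<in> borel_measurable (lebesgue_on A)" "0 < c"
  shows "Lnorm q A (\<lambda>x. ennreal c * g x) = ennreal c * Lnorm q A g"
proof (rule order.antisym)
  have inv: "ennreal c * (ennreal (1 / c) * y) = y" "ennreal (1 / c) * (ennreal c * y) = y" for y
    using assms(3) by (simp_all flip: mult.assoc ennreal_mult)
  \<comment> \<open>The reverse inequality is the general one applied with the inverse
    constant.\<close>
  have "Lnorm q A (\<lambda>x. ennreal (1 / c) * (ennreal c * g x))
          \<le> ennreal (1 / c) * Lnorm q A (\<lambda>x. ennreal c * g x)"
    using assms by (intro Lnorm_cmult_le) auto
  then have "Lnorm q A g \<le> ennreal (1 / c) * Lnorm q A (\<lambda>x. ennreal c * g x)"
    by (simp add: inv)
  from mult_left_mono[OF this, of "ennreal c"]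
  show "ennreal c * Lnorm q A g \<le> Lnorm q A (\<lambda>x. ennreal c * g x)"
    by (simp add: inv)
qed (use assms in \<open>auto intro: Lnorm_cmult_le\<close>)

lemma Lnorm_add_le:
  assumes "0 < q"
  obtains C :: real where "1 \<le> C"
    "\<And>A g h. g \<in> borel_measurable (lebesgue_on A) \<Longrightarrow> h \<in> borel_measurable (lebesgue_on A) \<Longrightarrow>
       Lnorm q A (\<lambda>x. g x + h x) \<le> ennreal C * (Lnorm q A g + Lnorm q A h)"
  using assms
proof (cases q rule: Lnorm_cases)
  case infinity
  show ?thesis
  proof (rule that[of 1])
    fix A and g h :: "real \<Rightarrow> ennreal"
    assume "g \<in> borel_measurable (lebesgue_on A)" "h \<in> borel_measurable (lebesgue_on A)"
    moreover have "AE x in lebesgue_on A. g x + h x \<le> esssup (lebesgue_on A) g + esssup (lebesgue_on A) h"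
      using esssup_AE[of g "lebesgue_on A"] esssup_AE[of h "lebesgue_on A"]
      by eventually_elim (rule add_mono)
    ultimately show "Lnorm q A (\<lambda>x. g x + h x) \<le> ennreal 1 * (Lnorm q A g + Lnorm q A h)"
      unfolding infinity Lnorm_infinity by (simp add: esssup_I)
  qed simp
next
  case (ereal Q)
  show ?thesis
  \<comment> \<open>The factor \<open>2\<close> is the \<open>Q\<close>-th root of the pointwise
    constant \<open>2 powr Q\<close>; the factor \<open>2 powr (1 / Q)\<close> comes from taking the
    root of a sum of two integrals.\<close>
  proof (rule that[of "2 * 2 powr (1 / Q)"])
    show "1 \<le> 2 * 2 powr (1 / Q)"
      using ge_one_powr_ge_zero[of 2 "1 / Q"] ereal(2) by simp
    fix A and g h :: "real \<Rightarrow> ennreal"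
    assume [measurable]: "g \<in> borel_measurable (lebesgue_on A)" "h \<in> borel_measurable (lebesgue_on A)"
    let ?I = "\<lambda>g. \<integral>\<^sup>+ x. ennpowr (g x) Q \<partial>lebesgue_on A"
    have "?I (\<lambda>x. g x + h x) \<le> (\<integral>\<^sup>+ x. ennreal (2 powr Q) * (ennpowr (g x) Q + ennpowr (h x) Q) \<partial>lebesgue_on A)"
      using ereal by (intro nn_integral_mono ennpowr_add_le)
    also have "\<dots> = ennreal (2 powr Q) * (?I g + ?I h)"
      by (simp add: nn_integral_cmult nn_integral_add)
    finally have "ennpowr (?I (\<lambda>x. g x + h x)) (1 / Q) \<le> ennpowr (ennreal (2 powr Q) * (?I g + ?I h)) (1 / Q)"
      using ereal by (intro ennpowr_mono) auto
    also have "\<dots> = ennreal 2 * ennpowr (?I g + ?I h) (1 / Q)"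
      using ereal by (simp add: ennpowr_mult ennpowr_ennreal powr_powr)
    also have "\<dots> \<le> ennreal 2 * (ennreal (2 powr (1 / Q)) * (ennpowr (?I g) (1 / Q) + ennpowr (?I h) (1 / Q)))"
      using ereal by (intro mult_left_mono ennpowr_add_le) auto
    finally show "Lnorm q A (\<lambda>x. g x + h x) \<le> ennreal (2 * 2 powr (1 / Q)) * (Lnorm q A g + Lnorm q A h)"
      using ereal by (simp add: Lnorm_ereal ennreal_mult mult.assoc)
  qed
qed

lemma Lnorm_SUP:
  assumes "0 < q" and [measurable]: "\<And>n. g n \<in> borel_measurable (lebesgue_on A)"
    and inc: "\<And>x. x \<in> A \<Longrightarrow> incseq (\<lambda>n::nat. g n x)"
  shows "Lnorm q A (\<lambda>x. SUP n. g n x) = (SUP n. Lnorm q A (g n))"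
  using assms(1)
proof (cases q rule: Lnorm_cases)
  case infinity
  show ?thesis
  proof (rule order.antisym)
    \<comment> \<open>The countably many exceptional null sets are merged into one.\<close>
    have "AE x in lebesgue_on A. \<forall>n. g n x \<le> esssup (lebesgue_on A) (g n)"
      by (subst AE_all_countable) (blast intro: esssup_AE)
    then have "AE x in lebesgue_on A. (SUP n. g n x) \<le> (SUP n. esssup (lebesgue_on A) (g n))"
      by eventually_elim (auto intro: SUP_mono)
    then show "Lnorm q A (\<lambda>x. SUP n. g n x) \<le> (SUP n. Lnorm q A (g n))"
      unfolding infinity Lnorm_infinity by (auto intro: esssup_I)
    show "(SUP n. Lnorm q A (g n)) \<le> Lnorm q A (\<lambda>x. SUP n. g n x)"
      using assms(1) by (auto intro!: SUP_least Lnorm_mono SUP_upper)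
  qed
next
  case (ereal Q)
  have "(\<integral>\<^sup>+ x. ennpowr (SUP n. g n x) Q \<partial>lebesgue_on A)
      = (\<integral>\<^sup>+ x. (SUP n. ennpowr (g n x) Q) \<partial>lebesgue_on A)"
    using ereal by (simp add: ennpowr_SUP)
  also have "\<dots> = (SUP n. \<integral>\<^sup>+ x. ennpowr (g n x) Q \<partial>lebesgue_on A)"
    using ereal inc
    by (intro nn_integral_monotone_convergence_SUP_AE AE_I2 ennpowr_mono)
       (auto simp: incseq_Suc_iff)
  finally show ?thesis using ereal by (simp add: Lnorm_ereal ennpowr_SUP)
qed

lemma Lnorm_eq_0_iff:
  assumes "0 < q" and [measurable]: "g \<in> borel_measurable (lebesgue_on A)"
  shows "Lnorm q A g = 0 \<longleftrightarrow> (AE x in lebesgue_on A. g x = 0)"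
  using assms(1)
proof (cases q rule: Lnorm_cases)
  case infinity
  have "AE x in lebesgue_on A. g x = 0" if "esssup (lebesgue_on A) g = 0"
    using esssup_AE[of g "lebesgue_on A"] that by simp
  moreover have "esssup (lebesgue_on A) g \<le> 0" if "AE x in lebesgue_on A. g x = 0"
    using that by (intro esssup_I) auto
  ultimately show ?thesis by (auto simp: infinity Lnorm_infinity)
next
  case (ereal Q)
  then show ?thesis by (simp add: Lnorm_ereal nn_integral_0_iff_AE)
qed

lemma Lnorm_finite_AE:
  assumes "0 < q" and [measurable]: "g \<in> borel_measurable (lebesgue_on A)" and "Lnorm q A g < \<infinity>"
  shows "AE x in lebesgue_on A. g x < \<infinity>"
  using assms(1)
proof (cases q rule: Lnorm_cases)
  case infinity
  show ?thesis
    using esssup_AE[of g "lebesgue_on A"] assms(3)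
    by (auto simp: infinity Lnorm_infinity elim!: eventually_mono)
next
  case (ereal Q)
  then have "(\<integral>\<^sup>+ x. ennpowr (g x) Q \<partial>lebesgue_on A) \<noteq> \<infinity>"
    using assms(3) by (auto simp: Lnorm_ereal)
  then have "AE x in lebesgue_on A. ennpowr (g x) Q \<noteq> \<infinity>"
    by (intro nn_integral_noteq_infinite) auto
  then show ?thesis by (auto simp: less_top elim!: eventually_mono)
qed

lemma Lnorm_subset:
  assumes "0 < q" "B \<subseteq> A" and B [measurable]: "B \<in> sets lebesgue" and A [measurable]: "A \<in> sets lebesgue"
    and g [measurable]: "g \<in> borel_measurable (lebesgue_on A)"
  shows "Lnorm q B g = Lnorm q A (\<lambda>x. g x * indicator B x)"
  using assms(1)
proof (cases q rule: Lnorm_cases)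
  case infinity
  have gB: "g \<in> borel_measurable (lebesgue_on B)"
    using measurable_restrict_mono[OF g assms(2)] by simp
  have BA: "B \<in> sets (lebesgue_on A)"
    using assms(2) by (simp add: sets_restrict_space_iff Int_absorb2 A B)
  then have gi: "(\<lambda>x. g x * indicator B x) \<in> borel_measurable (lebesgue_on A)"
    by measurable
  \<comment> \<open>An essential supremum is the infimum of the a.e. upper bounds, and in
    \<open>ennreal\<close> the value \<open>0\<close> outside \<open>B\<close> imposes no condition
    on such a bound.\<close>
  have AE_eq: "(AE x in lebesgue_on B. g x \<le> z) \<longleftrightarrow> (AE x in lebesgue_on A. g x * indicator B x \<le> z)" for z
    using assms(2) by (auto simp: AE_restrict_space_iff indicator_def elim!: eventually_mono)
  show ?thesis
    unfolding infinity Lnorm_infinity esssup_eq_AE[OF gB] esssup_eq_AE[OF gi] AE_eq ..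
next
  case (ereal Q)
  have "(\<integral>\<^sup>+ x. ennpowr (g x) Q \<partial>lebesgue_on B) = (\<integral>\<^sup>+ x. ennpowr (g x * indicator B x) Q \<partial>lebesgue_on A)"
    using assms(2)
    by (auto simp: nn_integral_restrict_space indicator_def intro!: nn_integral_cong)
  then show ?thesis using ereal by (simp add: Lnorm_ereal)
qed

lemma Lnorm_subset_le:
  assumes "0 < q" "B \<subseteq> A" "B \<in> sets lebesgue" "A \<in> sets lebesgue"
    and g: "g \<in> borel_measurable (lebesgue_on A)"
  shows "Lnorm q B g \<le> Lnorm q A g"
proof -
  have B: "B \<in> sets (lebesgue_on A)"
    using assms by (simp add: sets_restrict_space_iff Int_absorb2)
  have "(\<lambda>x. g x * indicator B x) \<in> borel_measurable (lebesgue_on A)"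
    using g B by measurable
  then show ?thesis
    unfolding Lnorm_subset[OF assms] using assms(1)
    by (intro Lnorm_mono) (auto simp: indicator_def)
qed

section \<open>The kernel \<open>min (t/v) (v/t)\<close> and dilations\<close>

text \<open>For positive arguments this is \<open>exp (- e * abs (ln t - ln v))\<close>. Exponents
  add, so parts of the decay can be split off and spent separately.\<close>

definition ratio_kernel :: "real \<Rightarrow> real \<Rightarrow> real \<Rightarrow> real" where
  "ratio_kernel e t v = min (t / v) (v / t) powr e"

lemma ratio_kernel_commute: "ratio_kernel e t v = ratio_kernel e v t"
  by (simp add: ratio_kernel_def min.commute)

lemma ratio_kernel_nonneg [simp]: "0 \<le> ratio_kernel e t v"
  by (simp add: ratio_kernel_def)

lemma ratio_kernel_le_1:
  assumes "0 \<le> e" "0 < t" "0 < v"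
  shows "ratio_kernel e t v \<le> 1"
proof -
  have "min (t / v) (v / t) \<le> 1"
    using assms by (cases "t \<le> v") (auto simp: min_le_iff_disj)
  then show ?thesis
    using assms unfolding ratio_kernel_def by (intro powr_le1) auto
qed

lemma ratio_kernel_powr: "ratio_kernel e t v powr a = ratio_kernel (e * a) t v"
  by (simp add: ratio_kernel_def powr_powr)

lemma ratio_kernel_add: "ratio_kernel (e + e') t v = ratio_kernel e t v * ratio_kernel e' t v"
  by (simp add: ratio_kernel_def powr_add)

text \<open>Moving from \<open>v\<close> down to \<open>u\<close> increases \<open>t / v\<close> and
  at most halves \<open>v / t\<close>, so the minimum loses at most a factor
  \<open>2\<close>.\<close>

lemma ratio_kernel_half:
  assumes "0 \<le> e" "0 < t" "0 < v" "v / 2 < u" "u < v"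
  shows "ratio_kernel e t v \<le> 2 powr e * ratio_kernel e t u"
proof -
  have "t / v \<le> t / u" "v / t \<le> 2 * (u / t)" "0 < t / u" "0 < u / t" "0 < u"
    using assms by (auto simp: divide_simps mult_ac)
  then have "min (t / v) (v / t) \<le> 2 * min (t / u) (u / t)"
    by (auto simp: min_def)
  then have "min (t / v) (v / t) powr e \<le> (2 * min (t / u) (u / t)) powr e"
    using assms by (intro powr_mono2) auto
  then show ?thesis
    using assms by (simp add: ratio_kernel_def powr_mult)
qed

lemma nn_integral_ratio_kernel_le:
  assumes "0 < e" "0 < t"
  shows "(\<integral>\<^sup>+ v. ennreal (ratio_kernel e t v / v) * indicator {0<..} v \<partial>lebesgue) \<le> ennreal (2 / e)"
proof -
  \<comment> \<open>The kernel is \<open>(v / t) powr e\<close> below \<open>t\<close> and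
    \<open>(t / v) powr e\<close> above; after division by \<open>v\<close> each half contributes
    \<open>1 / e\<close>.\<close>
  have "((\<lambda>v. v powr (e - 1)) has_integral (t powr e / e)) {0..t}"
    using has_integral_powr_from_0[of "e - 1" t] assms by simp
  from has_integral_mult_right[OF this, of "t powr (- e)"]
  have "((\<lambda>v. t powr (- e) * v powr (e - 1)) has_integral (1 / e)) {0..t}"
    using assms by (simp add: powr_minus)
  then have below: "(\<integral>\<^sup>+ v. ennreal (t powr (- e) * v powr (e - 1)) * indicator {0..t} v \<partial>lborel) = ennreal (1 / e)"
    by (intro nn_integral_has_integral_lebesgue') auto
  \<comment> \<open>This antiderivative vanishes at infinity, so the half-line integral is minus its
    value at \<open>t\<close>.\<close>
  have "((\<lambda>v. - (t powr e / e) * v powr (- e)) \<longlongrightarrow> - (t powr e / e) * 0) at_top"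
    using assms by (intro tendsto_intros tendsto_neg_powr filterlim_ident) auto
  then have "(\<integral>\<^sup>+ v. ennreal (t powr e * v powr (- e - 1)) * indicator {t..} v \<partial>lborel)
      = ennreal (0 - (- (t powr e / e) * t powr (- e)))"
    using assms
    by (intro nn_integral_FTC_atLeast) (auto intro!: derivative_eq_intros simp: field_simps)
  also have "0 - (- (t powr e / e) * t powr (- e)) = 1 / e"
    using assms by (simp add: powr_minus)
  finally have above: "(\<integral>\<^sup>+ v. ennreal (t powr e * v powr (- e - 1)) * indicator {t..} v \<partial>lborel) = ennreal (1 / e)" .
  have kernel: "ratio_kernel e t v / v \<le> t powr (- e) * v powr (e - 1)" if "0 < v" "v \<le> t" for v
  proof -
    have "ratio_kernel e t v \<le> (v / t) powr e"
      using that assms unfolding ratio_kernel_def by (intro powr_mono2) auto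
    then show ?thesis
      using that by (simp add: powr_divide powr_diff powr_minus divide_simps mult_ac)
  qed
  have kernel': "ratio_kernel e t v / v \<le> t powr e * v powr (- e - 1)" if "t \<le> v" for v
  proof -
    have "ratio_kernel e t v \<le> (t / v) powr e"
      using that assms unfolding ratio_kernel_def by (intro powr_mono2) auto
    then show ?thesis
      using that assms by (simp add: powr_divide powr_diff powr_minus divide_simps mult_ac)
  qed
  have "(\<integral>\<^sup>+ v. ennreal (ratio_kernel e t v / v) * indicator {0<..} v \<partial>lebesgue)
      \<le> (\<integral>\<^sup>+ v. ennreal (t powr (- e) * v powr (e - 1)) * indicator {0..t} v
            + ennreal (t powr e * v powr (- e - 1)) * indicator {t..} v \<partial>lebesgue)"
    using kernel kernel'
    by (intro nn_integral_mono) (auto simp: indicator_def not_le intro!: ennreal_leI add_increasing2)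
  also have "\<dots> = ennreal (1 / e) + ennreal (1 / e)"
    using above below by (simp add: nn_integral_completion nn_integral_add)
  also have "\<dots> = ennreal (2 / e)"
    using assms by (simp flip: ennreal_plus)
  finally show ?thesis .
qed

text \<open>Turns the factor \<open>u powr (- rcp q)\<close> into the density of
  \<open>du/u\<close>. An \<open>L_q(du/u)\<close> norm is always written as \<open>Lnorm\<close> of
  a function carrying this factor, which is \<open>1\<close> on the half-line when
  \<open>q = \<infinity>\<close>.\<close>

lemma ennpowr_weight:
  assumes "0 < Q" "0 < u" "0 \<le> k"
  shows "ennpowr (ennreal (k * u powr (- (1 / Q)))) Q = ennreal (k powr Q / u)"
  using assms by (simp add: ennpowr_ennreal powr_mult powr_divide powr_powr powr_minus_divide)

lemma borel_measurable_ratio_kernel [measurable (raw)]: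
  assumes [measurable]: "f \<in> borel_measurable M" "g \<in> borel_measurable M"
  shows "(\<lambda>x. ratio_kernel e (f x) (g x)) \<in> borel_measurable M"
  unfolding ratio_kernel_def by measurable

lemma lebesgue_on_ident_measurable [measurable]: "(\<lambda>x. x) \<in> borel_measurable (lebesgue_on A)"
  by (simp add: measurable_restrict_space1 measurable_completion)

text \<open>The \<open>Q\<close>-th power of the kernel is the kernel with exponent
  \<open>e * Q\<close>, of integral at most \<open>2 / (e * Q)\<close>. Uniformity in
  \<open>A\<close> and \<open>t\<close> allows one constant for all averaging intervals.\<close>

lemma Lnorm_ratio_kernel_le:
  assumes "0 < q" "0 < e"
  obtains K :: real where "0 < K"
    "\<And>A t. A \<in> sets lebesgue \<Longrightarrow> A \<subseteq> {0<..} \<Longrightarrow> 0 < t \<Longrightarrow>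
       Lnorm q A (\<lambda>v. ennreal (ratio_kernel e t v * v powr (- rcp q))) \<le> ennreal K"
  using assms(1)
proof (cases q rule: Lnorm_cases)
  case infinity
  show ?thesis
  proof (rule that[of 1])
    fix A :: "real set" and t :: real
    assume "A \<in> sets lebesgue" "A \<subseteq> {0<..}" "0 < t"
    then show "Lnorm q A (\<lambda>v. ennreal (ratio_kernel e t v * v powr (- rcp q))) \<le> ennreal 1"
      unfolding infinity Lnorm_infinity using assms(2)
      by (intro esssup_I AE_I2) (auto intro!: ratio_kernel_le_1 simp del: ennreal_1 simp: subset_iff)
  qed simp
next
  case (ereal Q)
  show ?thesis
  proof (rule that[of "(2 / (e * Q)) powr (1 / Q)"])
    show "0 < (2 / (e * Q)) powr (1 / Q)" using ereal assms by simp
    fix A :: "real set" and t :: real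
    assume A: "A \<in> sets lebesgue" "A \<subseteq> {0<..}" "0 < t"
    have "(\<integral>\<^sup>+ v. ennpowr (ennreal (ratio_kernel e t v * v powr (- rcp q))) Q \<partial>lebesgue_on A)
      = (\<integral>\<^sup>+ v. ennreal (ratio_kernel (e * Q) t v / v) * indicator A v \<partial>lebesgue)"
      using A ereal
      by (auto simp: nn_integral_restrict_space ennpowr_weight ratio_kernel_powr indicator_def subset_iff
               intro!: nn_integral_cong)
    also have "\<dots> \<le> (\<integral>\<^sup>+ v. ennreal (ratio_kernel (e * Q) t v / v) * indicator {0<..} v \<partial>lebesgue)"
      using A by (intro nn_integral_mono mult_left_mono) (auto simp: indicator_def)
    also have "\<dots> \<le> ennreal (2 / (e * Q))"
      using A ereal assms by (intro nn_integral_ratio_kernel_le) auto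
    finally have "ennpowr (\<integral>\<^sup>+ v. ennpowr (ennreal (ratio_kernel e t v * v powr (- rcp q))) Q \<partial>lebesgue_on A) (1 / Q)
        \<le> ennpowr (ennreal (2 / (e * Q))) (1 / Q)"
      using ereal by (intro ennpowr_mono) auto
    then show "Lnorm q A (\<lambda>v. ennreal (ratio_kernel e t v * v powr (- rcp q))) \<le> ennreal ((2 / (e * Q)) powr (1 / Q))"
      using ereal assms by (simp add: Lnorm_ereal ennpowr_ennreal)
  qed
qed

section \<open>Convolution with the kernel in \<open>L_q(dt/t)\<close>\<close>

lemma sigma_finite_lebesgue: "sigma_finite_measure (lebesgue :: real measure)"
proof
  show "\<exists>A. countable A \<and> A \<subseteq> sets (lebesgue :: real measure) \<and> \<Union> A = space lebesgue \<and>
      (\<forall>a\<in>A. emeasure lebesgue a \<noteq> \<infinity>)"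
  proof (intro exI[of _ "range (\<lambda>n::nat. {- real n..real n})"] conjI)
    have "\<exists>n::nat. - real n \<le> x \<and> x \<le> real n" for x :: real
      using real_arch_simple[of "\<bar>x\<bar>"] by (auto simp: abs_le_iff minus_le_iff)
    then show "(\<Union>n::nat. {- real n..real n}) = space lebesgue" by auto
  qed auto
qed

text \<open>A Schur test with exponent 1: once the integrals are exchanged, the
  \<open>t\<close>-integral for fixed \<open>u\<close> involves the kernel alone and is at most
  \<open>2 / e\<close>.\<close>

lemma nn_integral_ratio_kernel_Fubini:
  fixes H :: "real \<Rightarrow> ennreal"
  assumes "0 < e" and [measurable]: "H \<in> borel_measurable lebesgue" "A \<in> sets lebesgue" and A: "A \<subseteq> {0<..}"
  shows "(\<integral>\<^sup>+ t\<in>A. ennreal (1 / t) * (\<integral>\<^sup>+ u\<in>A. ennreal (ratio_kernel e t u / u) * H u \<partial>lebesgue) \<partial>lebesgue)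
    \<le> ennreal (2 / e) * (\<integral>\<^sup>+ u\<in>A. ennreal (1 / u) * H u \<partial>lebesgue)"
proof -
  interpret sigma_finite_measure "lebesgue :: real measure" by (rule sigma_finite_lebesgue)
  interpret pair_sigma_finite "lebesgue :: real measure" "lebesgue :: real measure" ..
  have [measurable]: "(\<lambda>x. x) \<in> borel_measurable (lebesgue :: real measure)"
    by (simp add: measurable_completion)
  have [measurable]: "(\<lambda>x. fst x) \<in> borel_measurable ((lebesgue :: real measure) \<Otimes>\<^sub>M (lebesgue :: real measure))"
    "(\<lambda>x. snd x) \<in> borel_measurable ((lebesgue :: real measure) \<Otimes>\<^sub>M (lebesgue :: real measure))"
    using measurable_compose[OF measurable_fst, of "\<lambda>x. x" "lebesgue :: real measure" borel "lebesgue :: real measure"]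
      measurable_compose[OF measurable_snd, of "\<lambda>x. x" "lebesgue :: real measure" borel "lebesgue :: real measure"]
    by auto
  let ?f = "\<lambda>u t. ennreal (1 / t) * (ennreal (ratio_kernel e t u / u) * H u * indicator A u) * indicator A t"
  \<comment> \<open>Symmetry of the kernel lets the densities \<open>1 / t\<close> and
    \<open>1 / u\<close> trade places, so that everything depending on \<open>u\<close> alone can
    leave the \<open>t\<close>-integral.\<close>
  have swap: "?f u t = ennreal (1 / u) * H u * indicator A u * (ennreal (ratio_kernel e u t / t) * indicator A t)" for u t
  proof (cases "u \<in> A \<and> t \<in> A")
    case True
    then have "0 < u" "0 < t" using A by auto
    then have "ennreal (1 / t) * ennreal (ratio_kernel e t u / u) = ennreal (1 / u) * ennreal (ratio_kernel e u t / t)"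
      by (simp add: ratio_kernel_commute[of e u] mult.commute flip: ennreal_mult)
    then have "ennreal (1 / t) * ennreal (ratio_kernel e t u / u) * H u
        = ennreal (1 / u) * ennreal (ratio_kernel e u t / t) * H u" by simp
    then show ?thesis using True by (simp add: mult.assoc mult.commute[of "H u"])
  qed auto
  have "(\<integral>\<^sup>+ t\<in>A. ennreal (1 / t) * (\<integral>\<^sup>+ u\<in>A. ennreal (ratio_kernel e t u / u) * H u \<partial>lebesgue) \<partial>lebesgue)
     = (\<integral>\<^sup>+ t. (\<integral>\<^sup>+ u. ?f u t \<partial>lebesgue) \<partial>lebesgue)"
    by (intro nn_integral_cong) (simp add: nn_integral_cmult nn_integral_multc)
  also have "\<dots> = (\<integral>\<^sup>+ u. (\<integral>\<^sup>+ t. ?f u t \<partial>lebesgue) \<partial>lebesgue)"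
    by (rule Fubini') measurable
  also have "\<dots> = (\<integral>\<^sup>+ u. (\<integral>\<^sup>+ t. ennreal (1 / u) * H u * indicator A u * (ennreal (ratio_kernel e u t / t) * indicator A t) \<partial>lebesgue) \<partial>lebesgue)"
    by (simp add: swap)
  also have "\<dots> = (\<integral>\<^sup>+ u. ennreal (1 / u) * H u * indicator A u * (\<integral>\<^sup>+ t. ennreal (ratio_kernel e u t / t) * indicator A t \<partial>lebesgue) \<partial>lebesgue)"
    by (simp add: nn_integral_cmult)
  also have "\<dots> \<le> (\<integral>\<^sup>+ u. ennreal (1 / u) * H u * indicator A u * ennreal (2 / e) \<partial>lebesgue)"
  proof (intro nn_integral_mono)
    fix u :: real
    have "(\<integral>\<^sup>+ t. ennreal (ratio_kernel e u t / t) * indicator A t \<partial>lebesgue) \<le> ennreal (2 / e)" if "u \<in> A"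
    proof -
      have "(\<integral>\<^sup>+ t. ennreal (ratio_kernel e u t / t) * indicator A t \<partial>lebesgue)
        \<le> (\<integral>\<^sup>+ t. ennreal (ratio_kernel e u t / t) * indicator {0<..} t \<partial>lebesgue)"
        using A by (intro nn_integral_mono mult_left_mono) (auto simp: indicator_def)
      also have "\<dots> \<le> ennreal (2 / e)"
        using A that assms(1) by (intro nn_integral_ratio_kernel_le) auto
      finally show ?thesis .
    qed
    then show "ennreal (1 / u) * H u * indicator A u * (\<integral>\<^sup>+ t. ennreal (ratio_kernel e u t / t) * indicator A t \<partial>lebesgue)
      \<le> ennreal (1 / u) * H u * indicator A u * ennreal (2 / e)"
      by (cases "u \<in> A") (auto intro: mult_left_mono)
  qed
  also have "\<dots> = ennreal (2 / e) * (\<integral>\<^sup>+ u\<in>A. ennreal (1 / u) * H u \<partial>lebesgue)"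
    by (subst nn_integral_multc) (simp_all add: mult.commute)
  finally show ?thesis .
qed

text \<open>The kernel sits inside a norm with the same exponent as the outer one. Raising to the
  power \<open>Q\<close> therefore gives a linear statement about the \<open>Q\<close>-th power of
  \<open>h\<close> with kernel exponent \<open>e * Q\<close>, for every \<open>Q > 0\<close>. For
  \<open>q = \<infinity>\<close> it is enough that the kernel is at most \<open>1\<close>.\<close>

lemma Lnorm_ratio_kernel_convolution:
  assumes "0 < q" "0 < e"
  obtains K :: real where "0 < K"
    "\<And>A h F. A \<in> sets lebesgue \<Longrightarrow> A \<subseteq> {0<..} \<Longrightarrow> h \<in> borel_measurable (lebesgue_on A) \<Longrightarrow>
       F \<in> borel_measurable (lebesgue_on A) \<Longrightarrow>
       (\<And>t. t \<in> A \<Longrightarrow> F t \<le> ennreal (t powr (- rcp q)) *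
           Lnorm q A (\<lambda>u. ennreal (ratio_kernel e t u * u powr (- rcp q)) * h u)) \<Longrightarrow>
       Lnorm q A F \<le> ennreal K * Lnorm q A (\<lambda>u. ennreal (u powr (- rcp q)) * h u)"
  using assms(1)
proof (cases q rule: Lnorm_cases)
  case infinity
  show ?thesis
  proof (rule that[of 1])
    fix A :: "real set" and h F :: "real \<Rightarrow> ennreal"
    assume A: "A \<in> sets lebesgue" "A \<subseteq> {0<..}" and h [measurable]: "h \<in> borel_measurable (lebesgue_on A)"
      and F: "F \<in> borel_measurable (lebesgue_on A)"
      and le: "\<And>t. t \<in> A \<Longrightarrow> F t \<le> ennreal (t powr (- rcp q)) *
           Lnorm q A (\<lambda>u. ennreal (ratio_kernel e t u * u powr (- rcp q)) * h u)"
    have "F t \<le> Lnorm q A (\<lambda>u. ennreal (u powr (- rcp q)) * h u)" if "t \<in> A" for t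
    proof -
      have "Lnorm q A (\<lambda>u. ennreal (ratio_kernel e t u * u powr (- rcp q)) * h u)
          \<le> Lnorm q A (\<lambda>u. ennreal (u powr (- rcp q)) * h u)"
        using A that assms
        by (intro Lnorm_mono mult_right_mono ennreal_leI mult_left_le_one_le ratio_kernel_le_1) auto
      then show ?thesis
        using le[OF that] A that by (auto simp: infinity)
    qed
    then show "Lnorm q A F \<le> ennreal 1 * Lnorm q A (\<lambda>u. ennreal (u powr (- rcp q)) * h u)"
      using F by (subst infinity, subst Lnorm_infinity) (auto intro!: esssup_I AE_I2)
  qed simp
next
  case (ereal Q)
  show ?thesis
  proof (rule that[of "(2 / (e * Q)) powr (1 / Q)"])
    show "0 < (2 / (e * Q)) powr (1 / Q)" using ereal assms by simp
    fix A :: "real set" and h F :: "real \<Rightarrow> ennreal"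
    assume A [measurable]: "A \<in> sets lebesgue" "A \<subseteq> {0<..}" and h [measurable]: "h \<in> borel_measurable (lebesgue_on A)"
      and le: "\<And>t. t \<in> A \<Longrightarrow> F t \<le> ennreal (t powr (- rcp q)) *
           Lnorm q A (\<lambda>u. ennreal (ratio_kernel e t u * u powr (- rcp q)) * h u)"
    \<comment> \<open>Extension by zero makes the integrand measurable on the whole line, where
      Fubini is applied.\<close>
    define H where "H u = ennpowr (h u) Q * indicator A u" for u
    have "(\<lambda>u. ennpowr (h u) Q) \<in> borel_measurable (lebesgue_on A)" by measurable
    then have [measurable]: "H \<in> borel_measurable lebesgue"
      unfolding H_def[abs_def] using A(1) by (subst (asm) borel_measurable_restrict_space_iff_ennreal) auto
    have inner: "ennpowr (Lnorm q A (\<lambda>u. ennreal (ratio_kernel e t u * u powr (- rcp q)) * h u)) Q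
        = (\<integral>\<^sup>+ u\<in>A. ennreal (ratio_kernel (e * Q) t u / u) * H u \<partial>lebesgue)" for t
      using A ereal
      by (auto simp: Lnorm_ereal ennpowr_ennpowr nn_integral_restrict_space ennpowr_mult ennpowr_weight
          ratio_kernel_powr H_def indicator_def subset_iff intro!: nn_integral_cong)
    have weight: "ennpowr (ennreal (t powr (- rcp q))) Q = ennreal (1 / t)" if "t \<in> A" for t
      using ennpowr_weight[of Q t 1] A that ereal by auto
    have "(\<integral>\<^sup>+ t. ennpowr (F t) Q \<partial>lebesgue_on A)
      \<le> (\<integral>\<^sup>+ t. ennpowr (ennreal (t powr (- rcp q)) *
            Lnorm q A (\<lambda>u. ennreal (ratio_kernel e t u * u powr (- rcp q)) * h u)) Q \<partial>lebesgue_on A)"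
      using le ereal by (intro nn_integral_mono ennpowr_mono) auto
    also have "\<dots> = (\<integral>\<^sup>+ t\<in>A. ennreal (1 / t) * (\<integral>\<^sup>+ u\<in>A. ennreal (ratio_kernel (e * Q) t u / u) * H u \<partial>lebesgue) \<partial>lebesgue)"
      unfolding ennpowr_mult inner
      by (auto simp: nn_integral_restrict_space weight indicator_def intro!: nn_integral_cong)
    also have "\<dots> \<le> ennreal (2 / (e * Q)) * (\<integral>\<^sup>+ u\<in>A. ennreal (1 / u) * H u \<partial>lebesgue)"
      using ereal assms A by (intro nn_integral_ratio_kernel_Fubini) auto
    also have "(\<integral>\<^sup>+ u\<in>A. ennreal (1 / u) * H u \<partial>lebesgue)
        = (\<integral>\<^sup>+ u. ennpowr (ennreal (u powr (- rcp q)) * h u) Q \<partial>lebesgue_on A)"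
      by (auto simp: nn_integral_restrict_space ennpowr_mult weight H_def indicator_def intro!: nn_integral_cong)
    finally have "ennpowr (\<integral>\<^sup>+ t. ennpowr (F t) Q \<partial>lebesgue_on A) (1 / Q)
      \<le> ennpowr (ennreal (2 / (e * Q)) * (\<integral>\<^sup>+ u. ennpowr (ennreal (u powr (- rcp q)) * h u) Q \<partial>lebesgue_on A)) (1 / Q)"
      using ereal by (intro ennpowr_mono) auto
    then show "Lnorm q A F \<le> ennreal ((2 / (e * Q)) powr (1 / Q)) * Lnorm q A (\<lambda>u. ennreal (u powr (- rcp q)) * h u)"
      using ereal assms by (simp add: Lnorm_ereal ennpowr_ennreal ennpowr_mult)
  qed
qed

text \<open>On the interval \<open>1 / u\<close> exceeds \<open>1 / v\<close>, so its
  \<open>du/u\<close>-mass is at least \<open>1 / 2\<close>, independently of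
  \<open>v\<close>.\<close>

lemma Lnorm_half_interval_ge:
  assumes "0 < q" "0 < v" and h [measurable]: "h \<in> borel_measurable (lebesgue_on {v/2<..<v})"
    and c: "\<And>u. v / 2 < u \<Longrightarrow> u < v \<Longrightarrow> c \<le> h u"
  shows "ennreal ((1 / 2) powr rcp q) * c \<le> Lnorm q {v/2<..<v} (\<lambda>u. ennreal (u powr (- rcp q)) * h u)"
  using assms(1)
proof (cases q rule: Lnorm_cases)
  case infinity
  \<comment> \<open>Only on a space of positive measure is the essential supremum of a constant that
    constant.\<close>
  have "emeasure (lebesgue_on {v/2<..<v}) (space (lebesgue_on {v/2<..<v})) \<noteq> 0"
    using assms(2) by (simp add: emeasure_restrict_space)
  from esssup_const[OF this, of c]
  have "c = Lnorm q {v/2<..<v} (\<lambda>_. c)"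
    by (simp add: infinity Lnorm_infinity)
  also have "\<dots> \<le> Lnorm q {v/2<..<v} (\<lambda>u. ennreal (u powr (- rcp q)) * h u)"
    using assms(1,2) c infinity by (intro Lnorm_mono) auto
  finally show ?thesis using infinity by simp
next
  case (ereal Q)
  have "ennreal (1 / 2) * ennpowr c Q = (ennreal (1 / v) * ennpowr c Q) * emeasure lebesgue {v/2<..<v}"
    using assms(2) by (simp add: mult.commute[of _ "ennpowr c Q"] mult.assoc flip: ennreal_mult)
  also have "\<dots> = (\<integral>\<^sup>+ u. ennreal (1 / v) * ennpowr c Q * indicator {v/2<..<v} u \<partial>lebesgue)"
    by (subst nn_integral_cmult_indicator) auto
  also have "\<dots> \<le> (\<integral>\<^sup>+ u. ennpowr (ennreal (u powr (- rcp q)) * h u) Q * indicator {v/2<..<v} u \<partial>lebesgue)"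
  proof (intro nn_integral_mono)
    fix u
    have "ennreal (1 / v) * ennpowr c Q \<le> ennreal (1 / u) * ennpowr (h u) Q" if "v / 2 < u" "u < v"
      using assms(2) that c ereal by (intro mult_mono ennreal_leI ennpowr_mono frac_le) auto
    then show "ennreal (1 / v) * ennpowr c Q * indicator {v/2<..<v} u
        \<le> ennpowr (ennreal (u powr (- rcp q)) * h u) Q * indicator {v/2<..<v} u"
      using ennpowr_weight[of Q u 1] ereal assms(2) by (auto simp: indicator_def ennpowr_mult)
  qed
  also have "\<dots> = (\<integral>\<^sup>+ u. ennpowr (ennreal (u powr (- rcp q)) * h u) Q \<partial>lebesgue_on {v/2<..<v})"
    by (simp add: nn_integral_restrict_space)
  finally have "ennpowr (ennreal (1 / 2) * ennpowr c Q) (1 / Q)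
      \<le> ennpowr (\<integral>\<^sup>+ u. ennpowr (ennreal (u powr (- rcp q)) * h u) Q \<partial>lebesgue_on {v/2<..<v}) (1 / Q)"
    using ereal by (intro ennpowr_mono) auto
  then show ?thesis
    using ereal ennpowr_ennreal[of "1 / 2" "1 / Q"]
    by (simp add: Lnorm_ereal ennpowr_mult ennpowr_ennpowr del: ennreal_divide_numeral)
qed

text \<open>Converts a pointwise comparison on one dyadic interval into a bound by the norm over a
  larger set. It serves the lower estimate with the inner exponent \<open>W\<close> and the upper
  estimate with the outer exponent \<open>r\<close>.\<close>

lemma le_Lnorm_half_interval:
  assumes "0 < q" "0 < v" "0 < C" "{v/2<..<v} \<subseteq> A" and A: "A \<in> sets lebesgue"
    and h: "h \<in> borel_measurable (lebesgue_on A)"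
    and c: "\<And>u. v / 2 < u \<Longrightarrow> u < v \<Longrightarrow> c \<le> ennreal C * h u"
  shows "c \<le> ennreal (C * 2 powr rcp q) * Lnorm q A (\<lambda>u. ennreal (u powr (- rcp q)) * h u)"
proof -
  have h' [measurable]: "h \<in> borel_measurable (lebesgue_on {v/2<..<v})"
    using measurable_restrict_mono[OF h assms(4)] .
  have [measurable]: "(\<lambda>u. ennreal (u powr (- rcp q)) * h u) \<in> borel_measurable (lebesgue_on A)"
    using h by measurable
  have "ennreal ((1 / 2) powr rcp q) * c
      \<le> Lnorm q {v/2<..<v} (\<lambda>u. ennreal (u powr (- rcp q)) * (ennreal C * h u))"
    using assms(1,2) c by (intro Lnorm_half_interval_ge) auto
  also have "\<dots> = Lnorm q {v/2<..<v} (\<lambda>u. ennreal C * (ennreal (u powr (- rcp q)) * h u))"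
    by (simp add: mult.left_commute)
  also have "\<dots> \<le> ennreal C * Lnorm q {v/2<..<v} (\<lambda>u. ennreal (u powr (- rcp q)) * h u)"
    using assms(1) by (intro Lnorm_cmult_le) auto
  also have "\<dots> \<le> ennreal C * Lnorm q A (\<lambda>u. ennreal (u powr (- rcp q)) * h u)"
    using assms by (intro mult_left_mono Lnorm_subset_le) auto
  finally have "ennreal (2 powr rcp q) * (ennreal ((1 / 2) powr rcp q) * c)
      \<le> ennreal (2 powr rcp q) * (ennreal C * Lnorm q A (\<lambda>u. ennreal (u powr (- rcp q)) * h u))"
    by (intro mult_left_mono) auto
  also have "ennreal (2 powr rcp q) * (ennreal ((1 / 2) powr rcp q) * c) = c"
  proof -
    have "2 powr rcp q * (1 / 2) powr rcp q = 1" by (simp add: powr_divide)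
    then show ?thesis by (simp flip: mult.assoc ennreal_mult)
  qed
  finally show ?thesis
    using assms(3) by (simp add: ennreal_mult mult_ac)
qed

section \<open>Halving the argument on \<open>(0,L)\<close>\<close>

lemma einterval_0_subset: "einterval 0 L \<subseteq> {0<..}"
  by (auto simp: einterval_iff)

lemma einterval_0_down: "t \<in> einterval 0 L \<Longrightarrow> 0 < s \<Longrightarrow> s \<le> t \<Longrightarrow> s \<in> einterval 0 L"
  by (auto simp: einterval_iff intro: le_less_trans[of "ereal s" "ereal t"])

lemma measurable_half_einterval:
  fixes F :: "real \<Rightarrow> ennreal"
  assumes F: "F \<in> borel_measurable (lebesgue_on (einterval 0 L))"
  shows "(\<lambda>t. F (t / 2)) \<in> borel_measurable (lebesgue_on (einterval 0 L))"
proof -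
  have "(\<lambda>t. F t * indicator (einterval 0 L) t) \<in> borel_measurable lebesgue"
    using F by (subst (asm) borel_measurable_restrict_space_iff_ennreal) auto
  then have "(\<lambda>t. F ((1/2) *\<^sub>R t) * indicator (einterval 0 L) ((1/2) *\<^sub>R t)) \<in> borel_measurable lebesgue"
    by (rule measurable_compose[OF lebesgue_measurable_scaling])
  then have "(\<lambda>t. F ((1/2) *\<^sub>R t) * indicator (einterval 0 L) ((1/2) *\<^sub>R t)) \<in> borel_measurable (lebesgue_on (einterval 0 L))"
    by (rule measurable_restrict_space1)
  also have "?this \<longleftrightarrow> ?thesis"
    using einterval_0_down[of _ L "x / 2" for x] einterval_0_subset[of L]
    by (intro measurable_cong) (auto simp: subset_iff)
  finally show ?thesis .
qed

text \<open>The substitution carries \<open>(0,L)\<close> onto \<open>(0,L/2)\<close>, which lies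
  inside \<open>(0,L)\<close>. Halving is chosen because doubling would leave the interval when
  \<open>L = 1\<close>.\<close>

lemma nn_integral_half_einterval_le:
  fixes F :: "real \<Rightarrow> ennreal"
  assumes F: "F \<in> borel_measurable (lebesgue_on (einterval 0 L))"
  shows "(\<integral>\<^sup>+ t. F (t / 2) \<partial>lebesgue_on (einterval 0 L)) \<le> ennreal 2 * (\<integral>\<^sup>+ t. F t \<partial>lebesgue_on (einterval 0 L))"
proof -
  define G where "G t = F t * indicator (einterval 0 L) t" for t
  have G [measurable]: "G \<in> borel_measurable lebesgue"
    unfolding G_def[abs_def] using F by (subst (asm) borel_measurable_restrict_space_iff_ennreal) auto
  have "(\<integral>\<^sup>+ t. F (t / 2) \<partial>lebesgue_on (einterval 0 L)) \<le> (\<integral>\<^sup>+ t. G (t / 2) \<partial>lebesgue)"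
    using einterval_0_down[of _ L "x / 2" for x] einterval_0_subset[of L]
    by (auto simp: nn_integral_restrict_space G_def indicator_def subset_iff intro!: nn_integral_mono)
  also have "\<dots> = ennreal 2 * (ennreal \<bar>1 / 2\<bar> * (\<integral>\<^sup>+ t. G (0 + 1 / 2 * t) \<partial>lebesgue))"
    using ennreal_mult[of 2 "1 / 2"] by (simp flip: mult.assoc)
  also have "\<dots> = ennreal 2 * (\<integral>\<^sup>+ t. G t \<partial>lebesgue)"
    by (subst nn_integral_real_affine_lebesgue[of G "1/2" 0]) auto
  finally show ?thesis
    by (simp add: nn_integral_restrict_space G_def)
qed

lemma Lnorm_half_einterval_le:
  assumes "0 < q" and F [measurable]: "F \<in> borel_measurable (lebesgue_on (einterval 0 L))"
  shows "Lnorm q (einterval 0 L) (\<lambda>t. F (t / 2)) \<le> ennreal (2 powr rcp q) * Lnorm q (einterval 0 L) F"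
  using assms(1)
proof (cases q rule: Lnorm_cases)
  case infinity
  let ?M = "lebesgue_on (einterval 0 L)"
  \<comment> \<open>\<open>?G\<close> marks the points where \<open>F\<close> exceeds its essential
    supremum. The integral estimate shows that this null set has a null preimage under
    halving.\<close>
  let ?G = "\<lambda>t. indicator {esssup ?M F<..} (F t) :: ennreal"
  have "AE t in ?M. ?G t = 0"
    using esssup_AE[of F ?M] by (auto simp: indicator_def not_less elim!: eventually_mono)
  then have "(\<integral>\<^sup>+ t. ?G t \<partial>?M) = 0"
    by (simp add: nn_integral_0_iff_AE)
  then have "(\<integral>\<^sup>+ t. ?G (t / 2) \<partial>?M) = 0"
    using nn_integral_half_einterval_le[of ?G L] by simp
  then have "AE t in ?M. ?G (t / 2) = 0"
    using measurable_half_einterval[of ?G L] by (simp add: nn_integral_0_iff_AE)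
  then have "AE t in ?M. F (t / 2) \<le> esssup ?M F"
    by (auto simp: indicator_def not_less elim!: eventually_mono split: if_splits)
  then show ?thesis
    using measurable_half_einterval[OF F] by (auto simp: infinity Lnorm_infinity)
next
  case (ereal Q)
  have "ennpowr (\<integral>\<^sup>+ t. ennpowr (F (t / 2)) Q \<partial>lebesgue_on (einterval 0 L)) (1 / Q)
     \<le> ennpowr (ennreal 2 * (\<integral>\<^sup>+ t. ennpowr (F t) Q \<partial>lebesgue_on (einterval 0 L))) (1 / Q)"
    using ereal by (intro ennpowr_mono nn_integral_half_einterval_le) auto
  then show ?thesis
    using ereal ennpowr_ennreal[of 2 "1 / Q"] by (simp add: Lnorm_ereal ennpowr_mult)
qed

section \<open>The non-increasing rearrangement\<close>

text \<open>The hypothesis is quasi-concavity, shared by functions monotone in either direction;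
  superlevel sets of such functions are intervals.\<close>

lemma measurable_if_superlevel_interval:
  fixes g :: "real \<Rightarrow> ennreal"
  assumes "\<And>x y z. x \<in> einterval 0 L \<Longrightarrow> y \<in> einterval 0 L \<Longrightarrow> z \<in> einterval 0 L \<Longrightarrow>
    x \<le> z \<Longrightarrow> z \<le> y \<Longrightarrow> min (g x) (g y) \<le> g z"
  shows "g \<in> borel_measurable (lebesgue_on (einterval 0 L))"
proof (rule borel_measurableI_greater)
  fix a
  have "is_interval {x \<in> einterval 0 L. a < g x}"
    unfolding is_interval_1
  proof (intro ballI allI impI)
    fix x y z
    assume *: "x \<in> {x \<in> einterval 0 L. a < g x}" "y \<in> {x \<in> einterval 0 L. a < g x}" "x \<le> z \<and> z \<le> y"
    then have z: "z \<in> einterval 0 L"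
      using einterval_0_down[of y L z] einterval_0_subset[of L] by auto
    have "a < min (g x) (g y)" using * by simp
    also have "\<dots> \<le> g z" using * z by (intro assms) auto
    finally show "z \<in> {x \<in> einterval 0 L. a < g x}" using z by simp
  qed
  then have "{x \<in> einterval 0 L. a < g x} \<in> sets lebesgue"
    using real_interval_borel_measurable by auto
  then show "{x \<in> space (lebesgue_on (einterval 0 L)). a < g x} \<in> sets (lebesgue_on (einterval 0 L))"
    by (subst sets_restrict_space_iff) auto
qed

lemma measurable_antimono_on:
  fixes g :: "real \<Rightarrow> ennreal"
  assumes "antimono_on (einterval 0 L) g"
  shows "g \<in> borel_measurable (lebesgue_on (einterval 0 L))"
  using monotone_onD[OF assms] by (intro measurable_if_superlevel_interval) (auto simp: min_le_iff_disj)

lemma measurable_mono_on: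
  fixes g :: "real \<Rightarrow> ennreal"
  assumes "mono_on (einterval 0 L) g"
  shows "g \<in> borel_measurable (lebesgue_on (einterval 0 L))"
  using monotone_onD[OF assms] by (intro measurable_if_superlevel_interval) (auto simp: min_le_iff_disj)

section \<open>The distribution function and its generalised inverse\<close>

definition distrib_fun :: "ereal \<Rightarrow> (real \<Rightarrow> complex) \<Rightarrow> real \<Rightarrow> ennreal" where
  "distrib_fun L f l = emeasure lebesgue {x \<in> einterval 0 L. l < cmod (f x)}"

lemma rearr_eq_INF_distrib_fun:
  "rearr L f t = (INF l \<in> {l::real. 0 < l \<and> distrib_fun L f l \<le> ennreal t}. ennreal l)"
  by (simp only: rearr_def distrib_fun_def)

lemma sets_superlevel [measurable]:
  assumes "f \<in> meas_fun L"
  shows "{x \<in> einterval 0 L. l < cmod (f x)} \<in> sets lebesgue"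
proof -
  have "f \<in> borel_measurable (lebesgue_on (einterval 0 L))"
    using assms by (simp add: meas_fun_def)
  then have "{x \<in> space (lebesgue_on (einterval 0 L)). l < cmod (f x)} \<in> sets (lebesgue_on (einterval 0 L))"
    by measurable
  then show ?thesis by (subst (asm) sets_restrict_space_iff) auto
qed

lemma distrib_fun_antimono:
  "f \<in> meas_fun L \<Longrightarrow> l \<le> l' \<Longrightarrow> distrib_fun L f l' \<le> distrib_fun L f l"
  unfolding distrib_fun_def by (intro emeasure_mono sets_superlevel) auto

lemma distrib_fun_mono_AE:
  assumes "f \<in> meas_fun L" "g \<in> meas_fun L" "AE x in lebesgue_on (einterval 0 L). cmod (g x) \<le> cmod (f x)"
  shows "distrib_fun L g l \<le> distrib_fun L f l"
  unfolding distrib_fun_def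
  using assms by (intro emeasure_mono_AE sets_superlevel) (auto simp: AE_restrict_space_iff elim!: eventually_mono)

text \<open>Continuity of the measure along increasing sets; it relies on the strict inequality in
  the superlevel sets.\<close>

lemma distrib_fun_right_cont:
  assumes "f \<in> meas_fun L"
  shows "distrib_fun L f l = (SUP n. distrib_fun L f (l + 1 / real (Suc n)))"
proof -
  have eq: "{x \<in> einterval 0 L. l < cmod (f x)} = (\<Union>n. {x \<in> einterval 0 L. l + 1 / real (Suc n) < cmod (f x)})"
  proof (intro equalityI subsetI)
    fix x assume x: "x \<in> {x \<in> einterval 0 L. l < cmod (f x)}"
    then obtain n where "inverse (real (Suc n)) < cmod (f x) - l"
      using reals_Archimedean[of "cmod (f x) - l"] by auto
    then show "x \<in> (\<Union>n. {x \<in> einterval 0 L. l + 1 / real (Suc n) < cmod (f x)})"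
      using x by (auto simp: divide_inverse intro!: exI[of _ n])
  next
    fix x assume "x \<in> (\<Union>n. {x \<in> einterval 0 L. l + 1 / real (Suc n) < cmod (f x)})"
    then obtain n where "x \<in> einterval 0 L" "l + 1 / real (Suc n) < cmod (f x)" by auto
    moreover have "0 < 1 / real (Suc n)" by simp
    ultimately show "x \<in> {x \<in> einterval 0 L. l < cmod (f x)}"
      using less_trans[of l "l + 1 / real (Suc n)" "cmod (f x)"] by (simp del: of_nat_Suc)
  qed
  have "incseq (\<lambda>n. {x \<in> einterval 0 L. l + 1 / real (Suc n) < cmod (f x)})"
  proof (intro incseq_SucI subsetI)
    fix n x assume x: "x \<in> {x \<in> einterval 0 L. l + 1 / real (Suc n) < cmod (f x)}"
    have "1 / real (Suc (Suc n)) \<le> 1 / real (Suc n)" by (intro divide_left_mono) auto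
    then show "x \<in> {x \<in> einterval 0 L. l + 1 / real (Suc (Suc n)) < cmod (f x)}"
      using x by (auto simp del: of_nat_Suc)
  qed
  moreover have "range (\<lambda>n. {x \<in> einterval 0 L. l + 1 / real (Suc n) < cmod (f x)}) \<subseteq> sets lebesgue"
    using sets_superlevel[OF assms] by blast
  ultimately show ?thesis
    unfolding distrib_fun_def eq by (rule SUP_emeasure_incseq[symmetric, rotated])
qed

text \<open>If \<open>x\<close> exceeded \<open>y\<close>, then \<open>y\<close> would be finite and
  itself a threshold. Comparison through real thresholds is the form in which
  \<open>less_rearr_iff\<close> applies.\<close>

lemma ennreal_le_if_less_imp:
  fixes x y :: ennreal
  assumes "\<And>l. 0 \<le> l \<Longrightarrow> ennreal l < x \<Longrightarrow> ennreal l < y"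
  shows "x \<le> y"
proof (rule ccontr)
  assume "\<not> x \<le> y"
  then show False using assms[of "enn2real y"] by (cases y) (auto simp: not_le)
qed

text \<open>The rearrangement is the generalised inverse of the distribution function, and right
  continuity makes the equivalence exact with both inequalities strict. It replaces the infimum in
  the later comparisons.\<close>

lemma less_rearr_iff:
  assumes "f \<in> meas_fun L" "0 \<le> l"
  shows "ennreal l < rearr L f t \<longleftrightarrow> ennreal t < distrib_fun L f l"
proof
  assume "ennreal t < distrib_fun L f l"
  \<comment> \<open>Right continuity leaves room: the distribution function still exceeds
    \<open>t\<close> at a level strictly above \<open>l\<close>, so no admissible level lies below
    that one.\<close>
  then obtain n where n: "ennreal t < distrib_fun L f (l + 1 / real (Suc n))"
    unfolding distrib_fun_right_cont[OF assms(1), of l] less_SUP_iff by blast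
  have "ennreal l < ennreal (l + 1 / real (Suc n))"
    using assms by (intro ennreal_lessI) (auto intro: add_nonneg_pos)
  also have "\<dots> \<le> rearr L f t"
    unfolding rearr_eq_INF_distrib_fun
  proof (intro INF_greatest ennreal_leI)
    fix l' assume l': "l' \<in> {l. 0 < l \<and> distrib_fun L f l \<le> ennreal t}"
    show "l + 1 / real (Suc n) \<le> l'"
    proof (rule ccontr)
      assume "\<not> l + 1 / real (Suc n) \<le> l'"
      then have "l' \<le> l + 1 / real (Suc n)" by (rule nle_le[THEN iffD1, THEN conjunct1])
      note n
      also have "distrib_fun L f (l + 1 / real (Suc n)) \<le> distrib_fun L f l'"
        by (rule distrib_fun_antimono[OF assms(1)]) fact
      also have "\<dots> \<le> ennreal t" using l' by blast
      finally show False by simp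
    qed
  qed
  finally show "ennreal l < rearr L f t" .
next
  assume less: "ennreal l < rearr L f t"
  show "ennreal t < distrib_fun L f l"
  proof (rule ccontr)
    assume not: "\<not> ennreal t < distrib_fun L f l"
    \<comment> \<open>The level \<open>l\<close> may be \<open>0\<close>, which the infimum does not
      admit; hence the detour over \<open>l + e\<close>.\<close>
    have "rearr L f t \<le> ennreal l + ennreal e" if "0 < e" for e
    proof -
      have "distrib_fun L f (l + e) \<le> ennreal t"
        using that by (intro order_trans[OF distrib_fun_antimono[OF assms(1)] leI[OF not]]) simp
      then have "rearr L f t \<le> ennreal (l + e)"
        unfolding rearr_eq_INF_distrib_fun using assms that by (intro INF_lower) simp
      then show ?thesis using assms(2) that by (simp only: ennreal_plus less_imp_le)
    qed
    then have "rearr L f t \<le> ennreal l" by (rule ennreal_le_epsilon)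
    then show False using less by simp
  qed
qed

lemma rearr_antimono: "s \<le> t \<Longrightarrow> rearr L f t \<le> rearr L f s"
  unfolding rearr_eq_INF_distrib_fun using order_trans[OF _ ennreal_leI]
  by (intro INF_superset_mono) blast+

lemma antimono_on_rearr: "antimono_on A (rearr L f)"
  by (auto simp: monotone_on_def rearr_antimono)

lemma rearr_mono_AE:
  assumes "f \<in> meas_fun L" "g \<in> meas_fun L" "AE x in lebesgue_on (einterval 0 L). cmod (g x) \<le> cmod (f x)"
  shows "rearr L g t \<le> rearr L f t"
  unfolding rearr_eq_INF_distrib_fun
  using order_trans[OF distrib_fun_mono_AE[OF assms]] by (intro INF_superset_mono) blast+

lemma rearr_cong_AE:
  assumes "f \<in> meas_fun L" "g \<in> meas_fun L" "AE x in lebesgue_on (einterval 0 L). cmod (g x) = cmod (f x)"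
  shows "rearr L g t = rearr L f t"
  using assms by (intro order.antisym rearr_mono_AE) (auto elim: eventually_mono)

lemma rearr_cmult_le:
  assumes "f \<in> meas_fun L" "0 < c"
  shows "rearr L (\<lambda>x. complex_of_real c * f x) t \<le> ennreal c * rearr L f t"
proof (rule ennreal_le_if_less_imp)
  fix l :: real assume l: "0 \<le> l" "ennreal l < rearr L (\<lambda>x. complex_of_real c * f x) t"
  have cf: "(\<lambda>x. complex_of_real c * f x) \<in> meas_fun L"
    using assms by (simp add: meas_fun_def)
  have "distrib_fun L (\<lambda>x. complex_of_real c * f x) l = distrib_fun L f (l / c)"
    unfolding distrib_fun_def using assms
    by (intro arg_cong[where f = "emeasure lebesgue"] Collect_cong)
       (simp add: norm_mult pos_divide_less_eq mult.commute)
  then have "ennreal (l / c) < rearr L f t"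
    using l assms by (simp add: less_rearr_iff[OF cf] less_rearr_iff[OF assms(1)])
  then have "ennreal c * ennreal (l / c) < ennreal c * rearr L f t"
    using assms by (intro ennreal_mult_strict_left_mono) auto
  then show "ennreal l < ennreal c * rearr L f t"
    using assms l by (simp flip: ennreal_mult)
qed

lemma rearr_cmult:
  assumes f: "f \<in> meas_fun L" and c: "0 < c"
  shows "rearr L (\<lambda>x. complex_of_real c * f x) t = ennreal c * rearr L f t"
proof (rule order.antisym)
  have cf: "(\<lambda>x. complex_of_real c * f x) \<in> meas_fun L"
    using f by (simp add: meas_fun_def)
  have "rearr L f t \<le> ennreal (1 / c) * rearr L (\<lambda>x. complex_of_real c * f x) t"
    using rearr_cmult_le[OF cf, of "1 / c" t] c by (simp flip: mult.assoc of_real_mult)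
  from mult_left_mono[OF this, of "ennreal c"]
  show "ennreal c * rearr L f t \<le> rearr L (\<lambda>x. complex_of_real c * f x) t"
    using c by (simp flip: mult.assoc ennreal_mult)
qed (use assms rearr_cmult_le in auto)

lemma rearr_0: "rearr L (\<lambda>x. 0) t = 0"
proof -
  have "rearr L (\<lambda>x. 0) t \<le> ennreal 0"
  proof (rule ennreal_le_epsilon)
    fix e :: real assume "0 < e"
    then show "rearr L (\<lambda>x. 0) t \<le> ennreal 0 + ennreal e"
      unfolding rearr_def by (intro INF_lower2[of e]) auto
  qed
  then show ?thesis by simp
qed

text \<open>Where the sum exceeds \<open>a + c\<close> in modulus, \<open>f\<close> exceeds
  \<open>a\<close> or \<open>g\<close> exceeds \<open>c\<close>. With \<open>a\<close> and
  \<open>c\<close> the values of the rearrangements at \<open>t / 2\<close>, each of these sets has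
  measure at most \<open>t / 2\<close>.\<close>

lemma rearr_add_le:
  assumes "f \<in> meas_fun L" "g \<in> meas_fun L" "0 < t"
  shows "rearr L (\<lambda>x. f x + g x) t \<le> rearr L f (t / 2) + rearr L g (t / 2)"
proof (rule ccontr)
  let ?u = "rearr L f (t / 2)" and ?v = "rearr L g (t / 2)"
  assume "\<not> ?thesis"
  then have less: "?u + ?v < rearr L (\<lambda>x. f x + g x) t" by simp
  \<comment> \<open>Being strictly below another value makes both terms finite, so they can serve as
    real levels.\<close>
  have "?u + ?v < top" by (rule less_le_trans[OF less top_greatest])
  then obtain a c where ac: "?u = ennreal a" "0 \<le> a" "?v = ennreal c" "0 \<le> c"
    by (cases ?u; cases ?v) auto
  have fg: "(\<lambda>x. f x + g x) \<in> meas_fun L"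
    using assms by (auto simp: meas_fun_def)
  have "ennreal t < distrib_fun L (\<lambda>x. f x + g x) (a + c)"
    using less ac by (simp flip: less_rearr_iff[OF fg])
  also have "\<dots> \<le> emeasure lebesgue ({x \<in> einterval 0 L. a < cmod (f x)} \<union> {x \<in> einterval 0 L. c < cmod (g x)})"
    unfolding distrib_fun_def
  proof (intro emeasure_mono subsetI)
    fix x assume x: "x \<in> {x \<in> einterval 0 L. a + c < cmod (f x + g x)}"
    then show "x \<in> {x \<in> einterval 0 L. a < cmod (f x)} \<union> {x \<in> einterval 0 L. c < cmod (g x)}"
      using norm_triangle_ineq[of "f x" "g x"] by auto
  qed (use assms sets_superlevel in auto)
  also have "\<dots> \<le> distrib_fun L f a + distrib_fun L g c"
    unfolding distrib_fun_def using assms by (intro emeasure_subadditive sets_superlevel)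
  also have "\<dots> \<le> ennreal (t / 2) + ennreal (t / 2)"
    using less_rearr_iff[OF assms(1) ac(2), of "t / 2"] less_rearr_iff[OF assms(2) ac(4), of "t / 2"] ac
    by (intro add_mono) (auto simp: not_less[symmetric])
  also have "\<dots> = ennreal t"
    using assms by (simp flip: ennreal_plus)
  finally show False by simp
qed

text \<open>The condition \<open>l < cmod (f x)\<close> is open and hence holds for some
  \<open>F n x\<close> already; so the distribution functions increase to that of
  \<open>f\<close>.\<close>

lemma rearr_SUP:
  assumes F: "\<And>n::nat. F n \<in> meas_fun L" and f: "f \<in> meas_fun L"
    and lim: "AE x in lebesgue_on (einterval 0 L). incseq (\<lambda>n. cmod (F n x)) \<and> (\<lambda>n. F n x) \<longlonglongrightarrow> f x"
  shows "rearr L f t = (SUP n. rearr L (F n) t)"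
proof (rule order.antisym)
  let ?M = "lebesgue_on (einterval 0 L)"
  \<comment> \<open>As an integral the distribution function is accessible to monotone convergence
    under a hypothesis that holds only almost everywhere.\<close>
  have distrib: "distrib_fun L g l = (\<integral>\<^sup>+ x. indicator {l<..} (cmod (g x)) \<partial>?M)"
    if "g \<in> meas_fun L" for g l
  proof -
    have "(\<integral>\<^sup>+ x. indicator {l<..} (cmod (g x)) \<partial>?M)
        = (\<integral>\<^sup>+ x. indicator {x \<in> einterval 0 L. l < cmod (g x)} x \<partial>lebesgue)"
      by (auto simp: nn_integral_restrict_space indicator_def intro!: nn_integral_cong)
    then show ?thesis
      using sets_superlevel[OF that] by (simp add: distrib_fun_def)
  qed
  have le: "AE x in ?M. cmod (F n x) \<le> cmod (f x)" for n
    using lim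
  proof eventually_elim
    case (elim x)
    then have "(\<lambda>n. cmod (F n x)) \<longlonglongrightarrow> cmod (f x)" by (auto intro: tendsto_norm)
    with elim show ?case by (auto intro: incseq_le[of "\<lambda>n. cmod (F n x)"])
  qed
  show "rearr L f t \<le> (SUP n. rearr L (F n) t)"
  proof (rule ennreal_le_if_less_imp)
    fix l :: real assume l: "0 \<le> l" "ennreal l < rearr L f t"
    have [measurable]: "F n \<in> borel_measurable ?M" for n
      using F by (simp add: meas_fun_def)
    have "ennreal t < (\<integral>\<^sup>+ x. indicator {l<..} (cmod (f x)) \<partial>?M)"
      using l f by (simp add: less_rearr_iff distrib)
    also have "\<dots> \<le> (\<integral>\<^sup>+ x. (SUP n. indicator {l<..} (cmod (F n x))) \<partial>?M)"
    proof (rule nn_integral_mono_AE)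
      show "AE x in ?M. indicator {l<..} (cmod (f x)) \<le> (SUP n. indicator {l<..} (cmod (F n x)) :: ennreal)"
        using lim
      proof eventually_elim
        case (elim x)
        show ?case
        proof (cases "l < cmod (f x)")
          case True
          have "(\<lambda>n. cmod (F n x)) \<longlonglongrightarrow> cmod (f x)"
            using elim by (auto intro: tendsto_norm)
          then have "\<forall>\<^sub>F n in sequentially. l < cmod (F n x)"
            using True by (rule order_tendstoD)
          then obtain n where "l < cmod (F n x)" by (auto simp: eventually_sequentially)
          then show ?thesis using True by (intro SUP_upper2[of n]) auto
        qed auto
      qed
    qed
    also have "\<dots> = (SUP n. \<integral>\<^sup>+ x. indicator {l<..} (cmod (F n x)) \<partial>?M)"
      using lim
      by (intro nn_integral_monotone_convergence_SUP_AE)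
         (auto simp: incseq_Suc_iff indicator_def elim!: eventually_mono intro: less_le_trans)
    finally obtain n where "ennreal t < distrib_fun L (F n) l"
      using F by (auto simp: less_SUP_iff distrib)
    then have "ennreal l < rearr L (F n) t"
      using less_rearr_iff[OF F l(1)] by simp
    then show "ennreal l < (SUP n. rearr L (F n) t)"
      by (auto simp: less_SUP_iff)
  qed
  show "(SUP n. rearr L (F n) t) \<le> rearr L f t"
    using F f le by (intro SUP_least rearr_mono_AE)
qed

text \<open>The distribution function never exceeds the length of \<open>(0,L)\<close>, so an
  initial interval of that measure fits inside. With \<open>less_rearr_iff\<close> this expresses
  that \<open>f\<close> and its rearrangement are equimeasurable.\<close>

lemma emeasure_below_distrib_fun:
  assumes "L \<in> {1, \<infinity>}" "f \<in> meas_fun L"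
  shows "emeasure lebesgue {x \<in> einterval 0 L. ennreal x < distrib_fun L f l} = distrib_fun L f l"
proof (cases "distrib_fun L f l")
  case top
  have "L = \<infinity>"
  proof (rule ccontr)
    assume "L \<noteq> \<infinity>"
    then have "L = 1" using assms by auto
    then have "distrib_fun L f l \<le> emeasure lebesgue {0<..<1::real}"
      unfolding distrib_fun_def by (intro emeasure_mono) (auto simp: einterval_iff)
    then show False using top by (simp add: top_unique)
  qed
  then have "{x \<in> einterval 0 L. ennreal x < distrib_fun L f l} = {0<..}"
    using top by (auto simp: einterval_iff)
  moreover have "emeasure lebesgue {0::real<..} = \<infinity>"
  proof -
    have "ennreal (real n) \<le> emeasure lebesgue {0::real<..}" for n
    proof -
      have "ennreal (real n) = emeasure lebesgue {0<..<real n}" by simp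
      also have "\<dots> \<le> emeasure lebesgue {0::real<..}" by (intro emeasure_mono) auto
      finally show ?thesis .
    qed
    then have "(SUP n. of_nat n) \<le> emeasure lebesgue {0::real<..}"
      by (intro SUP_least) (simp add: ennreal_of_nat_eq_real_of_nat)
    then show ?thesis
      by (simp add: ennreal_SUP_of_nat_eq_top top_unique)
  qed
  ultimately show ?thesis using top by (simp only: infinity_ennreal_def simp_thms)
next
  case (real m)
  have "m \<le> 1" if "L = 1"
  proof -
    have "distrib_fun L f l \<le> emeasure lebesgue {0<..<1::real}"
      unfolding distrib_fun_def using that by (intro emeasure_mono) (auto simp: einterval_iff)
    then show ?thesis using real by simp
  qed
  then have "{x \<in> einterval 0 L. ennreal x < distrib_fun L f l} = {0<..<m}"
    using assms real by (auto simp: einterval_iff ennreal_less_iff)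
  then show ?thesis using real by simp
qed

lemma enn2real_rearr_meas_fun: "(\<lambda>t. complex_of_real (enn2real (rearr L f t))) \<in> meas_fun L"
proof -
  have [measurable]: "rearr L f \<in> borel_measurable (lebesgue_on (einterval 0 L))"
    by (intro measurable_antimono_on antimono_on_rearr)
  show ?thesis unfolding meas_fun_def by measurable
qed

text \<open>Equimeasurability on all levels \<open>l \<ge> 0\<close>. Finiteness is required because
  \<open>enn2real\<close> sends \<open>\<infinity>\<close> to \<open>0\<close> and would lose the
  points with the largest value.\<close>

lemma rearr_rearr:
  assumes "L \<in> {1, \<infinity>}" "f \<in> meas_fun L" and fin: "\<And>t. t \<in> einterval 0 L \<Longrightarrow> rearr L f t < \<infinity>"
  shows "rearr L (\<lambda>t. complex_of_real (enn2real (rearr L f t))) t = rearr L f t" (is "rearr L ?g t = _")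
proof -
  have "distrib_fun L ?g l = distrib_fun L f l" if "0 \<le> l" for l
  proof -
    have "{x \<in> einterval 0 L. l < cmod (?g x)} = {x \<in> einterval 0 L. ennreal l < rearr L f x}"
    proof (intro Collect_cong conj_cong refl)
      fix x assume "x \<in> einterval 0 L"
      from fin[OF this] show "l < cmod (?g x) \<longleftrightarrow> ennreal l < rearr L f x"
        using that by (cases "rearr L f x") (auto simp: ennreal_less_iff)
    qed
    then show ?thesis
      using emeasure_below_distrib_fun[OF assms(1,2), of l] that
      by (simp add: less_rearr_iff[OF assms(2) that] distrib_fun_def[of L ?g])
  qed
  then have "ennreal l < rearr L ?g t \<longleftrightarrow> ennreal l < rearr L f t" if "0 \<le> l" for l
    using that by (simp add: less_rearr_iff[OF enn2real_rearr_meas_fun] less_rearr_iff[OF assms(2)])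
  then show ?thesis by (intro order.antisym ennreal_le_if_less_imp) auto
qed

lemma rearr_eq_0_iff:
  assumes "0 < L" "f \<in> meas_fun L"
  shows "(\<forall>t\<in>einterval 0 L. rearr L f t = 0) \<longleftrightarrow> (AE x in lebesgue_on (einterval 0 L). f x = 0)"
proof
  assume 0: "\<forall>t\<in>einterval 0 L. rearr L f t = 0"
  obtain t0 where t0: "t0 \<in> einterval 0 L"
    using einterval_nonempty[of 0 L] assms by auto
  have "distrib_fun L f 0 \<le> 0 + ennreal e" if "0 < e" for e
  proof -
    \<comment> \<open>The rearrangement vanishes at arbitrarily small points, which bounds the
      measure of the support by arbitrarily small \<open>e\<close>; the minimum with
      \<open>t0\<close> keeps the point inside the interval.\<close>
    have "min t0 e \<in> einterval 0 L"
      using einterval_0_down[OF t0, of "min t0 e"] t0 that einterval_0_subset[of L] by auto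
    then have "distrib_fun L f 0 \<le> ennreal (min t0 e)"
      using less_rearr_iff[OF assms(2), of 0 "min t0 e"] 0 by (auto simp: not_less)
    also have "\<dots> \<le> ennreal e" by (intro ennreal_leI) auto
    finally show ?thesis by simp
  qed
  then have "distrib_fun L f 0 = 0"
    using ennreal_le_epsilon[of 0 "distrib_fun L f 0"] by auto
  then have "{x \<in> einterval 0 L. 0 < cmod (f x)} \<in> null_sets lebesgue"
    using sets_superlevel[OF assms(2), of 0] unfolding distrib_fun_def by (intro null_setsI)
  from AE_not_in[OF this] show "AE x in lebesgue_on (einterval 0 L). f x = 0"
    by (auto simp: AE_restrict_space_iff elim!: eventually_mono)
next
  assume "AE x in lebesgue_on (einterval 0 L). f x = 0"
  then have "rearr L f t = rearr L (\<lambda>x. 0) t" for t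
    using assms by (intro rearr_cong_AE) (auto simp: meas_fun_def)
  then show "\<forall>t\<in>einterval 0 L. rearr L f t = 0" by (simp add: rearr_0)
qed

text \<open>The set lies in \<open>(0,s]\<close> and so has measure at most \<open>s\<close>, while
  levels \<open>l \<ge> 1\<close> have empty superlevel sets.\<close>

lemma rearr_indicator_le:
  assumes "\<omega> \<in> sets lebesgue" "\<omega> \<subseteq> einterval 0 L" "\<And>x. x \<in> \<omega> \<Longrightarrow> x \<le> s"
  shows "rearr L (indicator \<omega>) t \<le> indicator {..<s} t"
proof (rule ennreal_le_if_less_imp)
  fix l :: real assume l: "0 \<le> l" "ennreal l < rearr L (indicator \<omega>) t"
  have ind: "(indicator \<omega> :: real \<Rightarrow> complex) \<in> meas_fun L"
  proof -
    have "(indicator \<omega> :: real \<Rightarrow> complex) \<in> borel_measurable lebesgue"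
      using assms(1) by (rule borel_measurable_indicator)
    then show ?thesis unfolding meas_fun_def by (rule measurable_restrict_space1)
  qed
  have t: "ennreal t < distrib_fun L (indicator \<omega>) l"
    using l less_rearr_iff[OF ind l(1)] by simp
  have "l < 1"
  proof (rule ccontr)
    assume "\<not> l < 1"
    then have empty: "{x \<in> einterval 0 L. l < cmod (indicator \<omega> x)} = {}"
      by (auto simp: indicator_def)
    show False using t unfolding distrib_fun_def empty by simp
  qed
  have "{x \<in> einterval 0 L. l < cmod (indicator \<omega> x)} \<subseteq> {0<..s}"
    using assms l einterval_0_subset[of L] by (auto simp: indicator_def split: if_splits)
  then have "distrib_fun L (indicator \<omega>) l \<le> emeasure lebesgue {0<..s}"
    unfolding distrib_fun_def by (intro emeasure_mono) auto
  with t have "ennreal t < emeasure lebesgue {0<..s}" by simp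
  then have "t < s" by (cases "0 \<le> s") (auto simp: ennreal_less_iff not_less[symmetric] ennreal_leI intro: ccontr)
  with \<open>l < 1\<close> show "ennreal l < indicator {..<s} t"
    using l by (simp add: ennreal_less_one_iff)
qed

section \<open>Slowly varying weights\<close>

lemma slowly_varying_pos: "d \<in> slowly_varying L \<Longrightarrow> t \<in> einterval 0 L \<Longrightarrow> 0 < d t"
  by (simp add: slowly_varying_def)

lemma slowly_varying_measurable: "d \<in> slowly_varying L \<Longrightarrow> d \<in> borel_measurable (lebesgue_on (einterval 0 L))"
  by (simp add: slowly_varying_def)

lemma sim_on_ennrealE:
  fixes F G :: "real \<Rightarrow> real"
  assumes "sim_on S (\<lambda>t. ennreal (F t)) (\<lambda>t. ennreal (G t))" "\<And>t. t \<in> S \<Longrightarrow> 0 < F t"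
  obtains c C where "0 < c" "0 < C" "\<And>t. t \<in> S \<Longrightarrow> c * G t \<le> F t" "\<And>t. t \<in> S \<Longrightarrow> F t \<le> C * G t"
proof -
  obtain c C where c: "0 < c" "c \<le> C"
    and le: "\<And>t. t \<in> S \<Longrightarrow> ennreal c * ennreal (G t) \<le> ennreal (F t)"
      "\<And>t. t \<in> S \<Longrightarrow> ennreal (F t) \<le> ennreal C * ennreal (G t)"
    using assms(1) unfolding sim_on_def by blast
  \<comment> \<open>A non-positive value of \<open>G\<close> is sent to \<open>0\<close> by
    \<open>ennreal\<close> and would contradict the upper bound for the positive
    \<open>F\<close>.\<close>
  have pos: "0 < G t" if "t \<in> S" for t
  proof (rule ccontr)
    assume "\<not> 0 < G t"
    then have "ennreal (G t) = 0" by (simp add: ennreal_neg)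
    with le(2)[OF that] assms(2)[OF that] show False by simp
  qed
  show ?thesis
  proof (rule that[of c C])
    fix t assume t: "t \<in> S"
    show "c * G t \<le> F t"
      using le(1)[OF t] pos[OF t] assms(2)[OF t] c by (simp flip: ennreal_mult)
    show "F t \<le> C * G t"
      using le(2)[OF t] pos[OF t] assms(2)[OF t] c by (simp flip: ennreal_mult)
  qed (use c in auto)
qed

text \<open>Combines both monotone equivalents in one symmetric inequality: the increasing one
  treats \<open>s \<le> t\<close>, the decreasing one \<open>s > t\<close>. The growth conditions
  enter the later estimates only in this form.\<close>

lemma slowly_varying_ratio:
  assumes d: "d \<in> slowly_varying L" and "0 < e"
  obtains K where "0 < K" "\<And>s t. s \<in> einterval 0 L \<Longrightarrow> t \<in> einterval 0 L \<Longrightarrow> ratio_kernel e s t * d s \<le> K * d t"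
proof -
  let ?I = "einterval 0 L"
  have pos: "0 < t" "0 < d t" if "t \<in> ?I" for t
    using that einterval_0_subset slowly_varying_pos[OF d] by auto
  obtain \<phi> where \<phi>: "mono_on ?I \<phi>" "sim_on ?I (\<lambda>t. ennreal (t powr e * d t)) (\<lambda>t. ennreal (\<phi> t))"
    using d \<open>0 < e\<close> unfolding slowly_varying_def by blast
  obtain \<psi> where \<psi>: "antimono_on ?I \<psi>" "sim_on ?I (\<lambda>t. ennreal (t powr (- e) * d t)) (\<lambda>t. ennreal (\<psi> t))"
    using d \<open>0 < e\<close> unfolding slowly_varying_def by blast
  obtain c C where c: "0 < c" "0 < C" and cC: "\<And>t. t \<in> ?I \<Longrightarrow> c * \<phi> t \<le> t powr e * d t"
      "\<And>t. t \<in> ?I \<Longrightarrow> t powr e * d t \<le> C * \<phi> t"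
    using sim_on_ennrealE[OF \<phi>(2)] pos by (metis mult_pos_pos powr_gt_zero less_irrefl)
  obtain c' C' where c': "0 < c'" "0 < C'" and cC': "\<And>t. t \<in> ?I \<Longrightarrow> c' * \<psi> t \<le> t powr (- e) * d t"
      "\<And>t. t \<in> ?I \<Longrightarrow> t powr (- e) * d t \<le> C' * \<psi> t"
    using sim_on_ennrealE[OF \<psi>(2)] pos by (metis mult_pos_pos powr_gt_zero less_irrefl)
  have up: "(s / t) powr e * d s \<le> C / c * d t" if "s \<in> ?I" "t \<in> ?I" "s \<le> t" for s t
  proof -
    have "\<phi> s \<le> \<phi> t" using \<phi>(1) that by (auto simp: monotone_on_def)
    have "s powr e * d s \<le> C * \<phi> s" using cC that by auto
    also have "\<dots> \<le> C * \<phi> t" using \<open>\<phi> s \<le> \<phi> t\<close> c by simp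
    also have "\<dots> \<le> C * (t powr e * d t / c)"
      using cC(1)[OF that(2)] c by (intro mult_left_mono) (auto simp: pos_le_divide_eq mult.commute)
    finally have "s powr e * d s \<le> t powr e * (C / c * d t)" by (simp add: field_simps)
    then show ?thesis
      using pos[OF that(1)] pos[OF that(2)] by (simp add: powr_divide pos_divide_le_eq mult.commute)
  qed
  have down: "(s / t) powr e * d t \<le> C' / c' * d s" if "s \<in> ?I" "t \<in> ?I" "s \<le> t" for s t
  proof -
    have "\<psi> t \<le> \<psi> s" using \<psi>(1) that by (auto simp: monotone_on_def)
    have "t powr (- e) * d t \<le> C' * \<psi> t" using cC' that by auto
    also have "\<dots> \<le> C' * \<psi> s" using \<open>\<psi> t \<le> \<psi> s\<close> c' by simp
    also have "\<dots> \<le> C' * (s powr (- e) * d s / c')"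
      using cC'(1)[OF that(1)] c' by (intro mult_left_mono) (auto simp: pos_le_divide_eq mult.commute)
    finally have "s powr e * (t powr (- e) * d t) \<le> s powr e * (C' * (s powr (- e) * d s / c'))"
      by (intro mult_left_mono) auto
    then show ?thesis
      using pos[OF that(1)] pos[OF that(2)]
      by (simp add: powr_divide powr_minus field_simps)
  qed
  show ?thesis
  proof (rule that[of "max (C / c) (C' / c')"])
    show "0 < max (C / c) (C' / c')" using c by (simp add: less_max_iff_disj)
    fix s t assume st: "s \<in> ?I" "t \<in> ?I"
    then have p: "0 < s" "0 < t" "0 < d s" "0 < d t" using pos by auto
    show "ratio_kernel e s t * d s \<le> max (C / c) (C' / c') * d t"
    proof (cases "s \<le> t")
      case True
      have "min (s / t) (t / s) \<le> s / t" by simp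
      then have "ratio_kernel e s t * d s \<le> (s / t) powr e * d s"
        unfolding ratio_kernel_def using p \<open>0 < e\<close> by (intro mult_right_mono powr_mono2) auto
      also have "\<dots> \<le> C / c * d t" using up st True by auto
      also have "\<dots> \<le> max (C / c) (C' / c') * d t" using p by (intro mult_right_mono) auto
      finally show ?thesis .
    next
      case False
      have "min (s / t) (t / s) \<le> t / s" by simp
      then have "ratio_kernel e s t * d s \<le> (t / s) powr e * d s"
        unfolding ratio_kernel_def using p \<open>0 < e\<close> by (intro mult_right_mono powr_mono2) auto
      also have "\<dots> \<le> C' / c' * d t" using down st False by auto
      also have "\<dots> \<le> max (C / c) (C' / c') * d t" using p by (intro mult_right_mono) auto
      finally show ?thesis .
    qed
  qed
qed

lemma slowly_varying_doubling:
  assumes d: "d \<in> slowly_varying L"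
  obtains K where "0 < K" "\<And>s t. s \<in> einterval 0 L \<Longrightarrow> t \<in> einterval 0 L \<Longrightarrow> s \<le> 2 * t \<Longrightarrow> t \<le> 2 * s \<Longrightarrow>
    s powr a * d s \<le> K * (t powr a * d t)"
proof -
  obtain K where K: "0 < K" "\<And>s t. s \<in> einterval 0 L \<Longrightarrow> t \<in> einterval 0 L \<Longrightarrow> ratio_kernel 1 s t * d s \<le> K * d t"
    using slowly_varying_ratio[OF d, of 1] by auto
  show ?thesis
  proof (rule that[of "2 powr \<bar>a\<bar> * (2 * K)"])
    show "0 < 2 powr \<bar>a\<bar> * (2 * K)" using K by simp
    fix s t assume st: "s \<in> einterval 0 L" "t \<in> einterval 0 L" "s \<le> 2 * t" "t \<le> 2 * s"
    then have p: "0 < s" "0 < t" "0 < d s" "0 < d t"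
      using einterval_0_subset slowly_varying_pos[OF d] by auto
    \<comment> \<open>With exponent \<open>1\<close> the kernel is the smaller of the two ratios, at
      least \<open>1 / 2\<close> for points within a factor \<open>2\<close> of each other.\<close>
    have "1 / 2 \<le> ratio_kernel 1 s t"
      using p st by (simp add: ratio_kernel_def field_simps)
    then have "1 / 2 * d s \<le> ratio_kernel 1 s t * d s" using p by (intro mult_right_mono) auto
    also have "\<dots> \<le> K * d t" using K st by auto
    finally have ds: "d s \<le> 2 * K * d t" by simp
    have "(s / t) powr a \<le> 2 powr \<bar>a\<bar>"
    proof (cases "0 \<le> a")
      case True
      then show ?thesis using p st by (auto simp: pos_divide_le_eq intro!: powr_mono2)
    next
      case False
      have "(s / t) powr a = (t / s) powr (- a)"
        using p by (simp add: powr_divide powr_minus field_simps)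
      also have "\<dots> \<le> 2 powr (- a)"
        using p st False by (intro powr_mono2) (auto simp: pos_divide_le_eq)
      finally show ?thesis using False by simp
    qed
    then have "s powr a \<le> 2 powr \<bar>a\<bar> * t powr a"
      using p by (simp add: powr_divide pos_divide_le_eq)
    then have "s powr a * d s \<le> (2 powr \<bar>a\<bar> * t powr a) * (2 * K * d t)"
      using ds p by (intro mult_mono) auto
    then show "s powr a * d s \<le> 2 powr \<bar>a\<bar> * (2 * K) * (t powr a * d t)"
      by (simp add: mult_ac)
  qed
qed

section \<open>The weighted quasi-norm of the Lorentz-Karamata space\<close>

lemma Bnorm_measurable:
  assumes "b \<in> slowly_varying L" "g \<in> borel_measurable (lebesgue_on (einterval 0 L))"
  shows "(\<lambda>t. ennreal (t powr a * b t) * g t) \<in> borel_measurable (lebesgue_on (einterval 0 L))"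
  using slowly_varying_measurable[OF assms(1)] assms(2) by measurable

lemma Bnorm_mono:
  assumes "0 < r" "b \<in> slowly_varying L" "g \<in> borel_measurable (lebesgue_on (einterval 0 L))"
    "\<And>t. t \<in> einterval 0 L \<Longrightarrow> g t \<le> h t"
  shows "Bnorm L p r b g \<le> Bnorm L p r b h"
  unfolding Bnorm_def using assms by (intro Lnorm_mono Bnorm_measurable mult_left_mono) auto

lemma Bnorm_cmult:
  assumes "0 < r" "b \<in> slowly_varying L" "g \<in> borel_measurable (lebesgue_on (einterval 0 L))" "0 < c"
  shows "Bnorm L p r b (\<lambda>t. ennreal c * g t) = ennreal c * Bnorm L p r b g"
  unfolding Bnorm_def
  using Lnorm_cmult[OF assms(1) Bnorm_measurable[OF assms(2,3), of "rcp p - rcp r"] assms(4)]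
  by (simp add: mult.left_commute)

lemma Bnorm_SUP:
  assumes "0 < r" "b \<in> slowly_varying L" "\<And>n::nat. g n \<in> borel_measurable (lebesgue_on (einterval 0 L))"
    "\<And>t. t \<in> einterval 0 L \<Longrightarrow> incseq (\<lambda>n. g n t)"
  shows "Bnorm L p r b (\<lambda>t. SUP n. g n t) = (SUP n. Bnorm L p r b (g n))"
proof -
  have "Bnorm L p r b (\<lambda>t. SUP n. g n t)
      = Lnorm r (einterval 0 L) (\<lambda>t. SUP n. ennreal (t powr (rcp p - rcp r) * b t) * g n t)"
    unfolding Bnorm_def by (simp add: SUP_mult_left_ennreal)
  also have "\<dots> = (SUP n. Bnorm L p r b (g n))"
    unfolding Bnorm_def using assms
    by (intro Lnorm_SUP Bnorm_measurable) (auto simp: incseq_def intro: mult_left_mono)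
  finally show ?thesis .
qed

lemma Bnorm_add_le:
  assumes "0 < r" "b \<in> slowly_varying L"
  obtains C :: real where "1 \<le> C"
    "\<And>g h. g \<in> borel_measurable (lebesgue_on (einterval 0 L)) \<Longrightarrow> h \<in> borel_measurable (lebesgue_on (einterval 0 L)) \<Longrightarrow>
      Bnorm L p r b (\<lambda>t. g t + h t) \<le> ennreal C * (Bnorm L p r b g + Bnorm L p r b h)"
proof -
  obtain C :: real where C: "1 \<le> C"
    "\<And>A g h. g \<in> borel_measurable (lebesgue_on A) \<Longrightarrow> h \<in> borel_measurable (lebesgue_on A) \<Longrightarrow>
       Lnorm r A (\<lambda>x. g x + h x) \<le> ennreal C * (Lnorm r A g + Lnorm r A h)"
    using Lnorm_add_le[OF assms(1)] by blast
  show ?thesis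
    using C(2)[OF Bnorm_measurable[OF assms(2)] Bnorm_measurable[OF assms(2)]]
    by (intro that[OF C(1)]) (simp add: Bnorm_def distrib_left)
qed

text \<open>Doubling moves the weight from \<open>t\<close> to \<open>t / 2\<close>; what remains is
  a dilation of the unweighted norm.\<close>

lemma Bnorm_half_le:
  assumes "0 < r" "b \<in> slowly_varying L"
  obtains C :: real where "0 < C"
    "\<And>g. g \<in> borel_measurable (lebesgue_on (einterval 0 L)) \<Longrightarrow>
      Bnorm L p r b (\<lambda>t. g (t / 2)) \<le> ennreal C * Bnorm L p r b g"
proof -
  let ?I = "einterval 0 L" and ?a = "rcp p - rcp r"
  obtain K where K: "0 < K" "\<And>s t. s \<in> ?I \<Longrightarrow> t \<in> ?I \<Longrightarrow> s \<le> 2 * t \<Longrightarrow> t \<le> 2 * s \<Longrightarrow>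
    s powr ?a * b s \<le> K * (t powr ?a * b t)"
    using slowly_varying_doubling[OF assms(2), of ?a] by blast
  show ?thesis
  proof (rule that[of "K * 2 powr rcp r"])
    show "0 < K * 2 powr rcp r" using K by simp
    fix g :: "real \<Rightarrow> ennreal" assume g: "g \<in> borel_measurable (lebesgue_on ?I)"
    let ?F = "\<lambda>t. ennreal (t powr ?a * b t) * g t"
    have F: "?F \<in> borel_measurable (lebesgue_on ?I)" by (rule Bnorm_measurable[OF assms(2) g])
    have "Bnorm L p r b (\<lambda>t. g (t / 2)) \<le> Lnorm r ?I (\<lambda>t. ennreal K * ?F (t / 2))"
      unfolding Bnorm_def
    proof (intro Lnorm_mono Bnorm_measurable assms measurable_half_einterval[OF g])
      fix t assume t: "t \<in> ?I"
      then have t2: "t / 2 \<in> ?I" "0 < t" using einterval_0_down[of t L "t / 2"] einterval_0_subset[of L] by auto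
      have "ennreal (t powr ?a * b t) \<le> ennreal (K * ((t / 2) powr ?a * b (t / 2)))"
        using K(2)[OF t t2(1)] t2 by (intro ennreal_leI) auto
      also have "\<dots> = ennreal K * ennreal ((t / 2) powr ?a * b (t / 2))"
        using K slowly_varying_pos[OF assms(2) t2(1)] by (simp add: ennreal_mult)
      finally show "ennreal (t powr ?a * b t) * g (t / 2) \<le> ennreal K * ?F (t / 2)"
        by (simp add: mult_right_mono flip: mult.assoc)
    qed
    also have "\<dots> \<le> ennreal K * Lnorm r ?I (\<lambda>t. ?F (t / 2))"
      by (rule Lnorm_cmult_le[OF assms(1) measurable_half_einterval[OF F]])
    also have "\<dots> \<le> ennreal K * (ennreal (2 powr rcp r) * Lnorm r ?I ?F)"
      by (intro mult_left_mono Lnorm_half_einterval_le[OF assms(1) F]) auto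
    finally show "Bnorm L p r b (\<lambda>t. g (t / 2)) \<le> ennreal (K * 2 powr rcp r) * Bnorm L p r b g"
      using K by (simp add: Bnorm_def ennreal_mult mult.assoc)
  qed
qed

lemma Bnorm_eq_0_iff:
  assumes "0 < r" "b \<in> slowly_varying L" "g \<in> borel_measurable (lebesgue_on (einterval 0 L))"
  shows "Bnorm L p r b g = 0 \<longleftrightarrow> (AE t in lebesgue_on (einterval 0 L). g t = 0)"
proof -
  have "ennreal (t powr a * b t) \<noteq> 0" if "t \<in> einterval 0 L" for t a
  proof -
    have "0 < t powr a * b t"
      using slowly_varying_pos[OF assms(2) that] that einterval_0_subset[of L] by auto
    then show ?thesis by (simp add: ennreal_eq_0_iff not_le)
  qed
  then show ?thesis
    unfolding Bnorm_def using assms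
    by (subst Lnorm_eq_0_iff[OF assms(1) Bnorm_measurable]) (auto intro!: AE_cong)
qed

lemma Bnorm_finite_AE:
  assumes "0 < r" "b \<in> slowly_varying L" "g \<in> borel_measurable (lebesgue_on (einterval 0 L))"
    and "Bnorm L p r b g < \<infinity>"
  shows "AE t in lebesgue_on (einterval 0 L). g t < \<infinity>"
proof -
  have "AE t in lebesgue_on (einterval 0 L). ennreal (t powr (rcp p - rcp r) * b t) * g t < \<infinity>"
    using assms unfolding Bnorm_def by (intro Lnorm_finite_AE Bnorm_measurable)
  moreover have "AE t in lebesgue_on (einterval 0 L). t \<in> einterval 0 L"
    by (intro AE_I2) auto
  ultimately show ?thesis
  proof eventually_elim
    case (elim t)
    have "0 < t powr (rcp p - rcp r) * b t"
      using elim slowly_varying_pos[OF assms(2), of t] einterval_0_subset[of L] by auto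
    then have "ennreal (t powr (rcp p - rcp r) * b t) \<noteq> 0" by (simp add: ennreal_eq_0_iff not_le)
    then show ?case
      using elim by (cases "g t") (auto simp: ennreal_mult_eq_top_iff)
  qed
qed

text \<open>A null set cannot contain an initial interval. For non-increasing functions this
  upgrades vanishing or finiteness almost everywhere to every point.\<close>

lemma AE_einterval_ex_less:
  assumes "AE x in lebesgue_on (einterval 0 L). P x" "t \<in> einterval 0 L"
  shows "\<exists>s\<in>einterval 0 L. s < t \<and> P s"
proof (rule ccontr)
  assume *: "\<not> ?thesis"
  have t: "0 < t" using assms(2) einterval_0_subset by auto
  have "AE x in lebesgue. x \<in> einterval 0 L \<longrightarrow> P x"
    using assms(1) by (simp add: AE_restrict_space_iff)
  then have "AE x in lebesgue. x \<notin> {0<..<t}"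
  proof eventually_elim
    case (elim x)
    then show ?case using * einterval_0_down[OF assms(2), of x] by auto
  qed
  then have "{0<..<t} \<in> null_sets lebesgue"
    by (subst AE_iff_null_sets) auto
  then show False using t by (auto simp: null_sets_def)
qed

lemma ex_less_ennreal_real:
  fixes x :: ennreal
  assumes "0 < x"
  obtains c :: real where "0 < c" "ennreal c \<le> x"
proof (cases x)
  case (real y)
  then show ?thesis using that[of y] assms by auto
next
  case top
  then show ?thesis using that[of 1] by auto
qed

text \<open>A non-zero member of the space has a rearrangement bounded below by some
  \<open>c > 0\<close> up to some \<open>t0\<close>, so the indicator of that initial interval has
  finite norm. Finitely many doublings of the interval reach \<open>s\<close>.\<close>

lemma Bnorm_indicator_finite:
  assumes L: "L \<in> {1, \<infinity>}" and r: "0 < r" and b: "b \<in> slowly_varying L" and nontriv: "LK_nontrivial L p r b"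
  shows "Bnorm L p r b (indicator {..<s}) < \<infinity>"
proof -
  let ?I = "einterval 0 L"
  have ind [measurable]: "(indicator {..<s} :: real \<Rightarrow> ennreal) \<in> borel_measurable (lebesgue_on ?I)" for s
    by (intro measurable_restrict_space1 borel_measurable_indicator) auto
  obtain f where f: "f \<in> meas_fun L" "Bnorm L p r b (rearr L f) < \<infinity>" "\<not> (AE x in lebesgue_on ?I. f x = 0)"
    using nontriv unfolding LK_nontrivial_def LKspace_def LKnorm_def by blast
  have "0 < L" using L by auto
  then obtain t0 where t0: "t0 \<in> ?I" "rearr L f t0 \<noteq> 0"
    using rearr_eq_0_iff[OF _ f(1)] f(3) by blast
  then obtain c where c: "0 < c" "ennreal c \<le> rearr L f t0"
    using ex_less_ennreal_real[of "rearr L f t0"] by (auto simp: zero_less_iff_neq_zero)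
  have "ennreal c * Bnorm L p r b (indicator {..<t0}) = Bnorm L p r b (\<lambda>t. ennreal c * indicator {..<t0} t)"
    using Bnorm_cmult[OF r b ind c(1)] by simp
  also have "\<dots> \<le> Bnorm L p r b (rearr L f)"
    using c rearr_antimono[of _ t0 L f]
    by (intro Bnorm_mono r b) (auto simp: indicator_def intro: order_trans)
  finally have fin: "ennreal c * Bnorm L p r b (indicator {..<t0}) < \<infinity>"
    using f(2) by (rule le_less_trans)
  have base: "Bnorm L p r b (indicator {..<t0}) < \<infinity>"
    using fin c by (cases "Bnorm L p r b (indicator {..<t0})") (auto simp: ennreal_mult_top)
  obtain C :: real where C: "0 < C"
    "\<And>g. g \<in> borel_measurable (lebesgue_on ?I) \<Longrightarrow> Bnorm L p r b (\<lambda>t. g (t / 2)) \<le> ennreal C * Bnorm L p r b g"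
    using Bnorm_half_le[OF r b] by blast
  have pow: "Bnorm L p r b (indicator {..<2 ^ n * t0}) < \<infinity>" for n
  proof (induction n)
    case 0
    then show ?case using base by simp
  next
    case (Suc n)
    \<comment> \<open>Doubling the interval means halving the argument of its indicator, so the
      bounded dilation applies.\<close>
    have "(indicator {..<2 ^ Suc n * t0} :: real \<Rightarrow> ennreal) = (\<lambda>t. indicator {..<2 ^ n * t0} (t / 2))"
      by (auto simp: indicator_def)
    then have "Bnorm L p r b (indicator {..<2 ^ Suc n * t0}) \<le> ennreal C * Bnorm L p r b (indicator {..<2 ^ n * t0})"
      using C(2)[OF ind] by simp
    also have "\<dots> < \<infinity>" using Suc by (simp add: ennreal_mult_less_top)
    finally show ?case .
  qed
  have "0 < t0" using t0 einterval_0_subset by auto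
  obtain n where "s / t0 < 2 ^ n"
    using real_arch_pow[of 2 "s / t0"] by auto
  then have "s \<le> 2 ^ n * t0" using \<open>0 < t0\<close> by (simp add: field_simps)
  then have "Bnorm L p r b (indicator {..<s}) \<le> Bnorm L p r b (indicator {..<2 ^ n * t0})"
    by (intro Bnorm_mono r b ind) (auto simp: indicator_def)
  then show ?thesis using pow[of n] by (rule le_less_trans)
qed

text \<open>Homogeneity, monotonicity and the Fatou property have to hold exactly and are therefore
  required of \<open>\<Phi>\<close>. The behaviour at zero, the quasi-triangle inequality and
  finiteness on bounded sets tolerate constants and are carried over from \<open>Bnorm\<close>. In
  this way the quasi-triangle inequality only needs the subadditivity of rearrangements at the
  halved argument.\<close>

lemma equiv_ri_quasinorm_rearr:
  fixes \<Phi> :: "(real \<Rightarrow> ennreal) \<Rightarrow> ennreal"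
  assumes L: "L \<in> {1, \<infinity>}" and r: "0 < r" and b: "b \<in> slowly_varying L" and nontriv: "LK_nontrivial L p r b"
    and cmult: "\<And>g c. antimono_on (einterval 0 L) g \<Longrightarrow> 0 < c \<Longrightarrow> \<Phi> (\<lambda>t. ennreal c * g t) = ennreal c * \<Phi> g"
    and mono: "\<And>g h. antimono_on (einterval 0 L) g \<Longrightarrow> antimono_on (einterval 0 L) h \<Longrightarrow>
        (\<And>t. t \<in> einterval 0 L \<Longrightarrow> g t \<le> h t) \<Longrightarrow> \<Phi> g \<le> \<Phi> h"
    and SUP: "\<And>g. (\<And>n::nat. antimono_on (einterval 0 L) (g n)) \<Longrightarrow>
        (\<And>t. t \<in> einterval 0 L \<Longrightarrow> incseq (\<lambda>n. g n t)) \<Longrightarrow> \<Phi> (\<lambda>t. SUP n. g n t) = (SUP n. \<Phi> (g n))"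
    and C1: "0 < C1" "\<And>g. antimono_on (einterval 0 L) g \<Longrightarrow> Bnorm L p r b g \<le> ennreal C1 * \<Phi> g"
    and C2: "0 < C2" "\<And>g. antimono_on (einterval 0 L) g \<Longrightarrow> \<Phi> g \<le> ennreal C2 * Bnorm L p r b g"
  shows "sim_on (meas_fun L) (LKnorm L p r b) (\<lambda>f. \<Phi> (rearr L f))"
    and "equiv_ri_quasinorm L p r b (\<lambda>f. \<Phi> (rearr L f))"
proof -
  let ?I = "einterval 0 L"
  let ?M = "lebesgue_on ?I"
  have anti: "antimono_on ?I (rearr L f)" for f by (rule antimono_on_rearr)
  have meas: "rearr L f \<in> borel_measurable ?M" for f by (rule measurable_antimono_on[OF anti])
  have inv_mult: "ennreal (1 / c) * (ennreal c * x) = x" if "0 < c" for c x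
    using that by (simp flip: mult.assoc ennreal_mult)
  have sim_aux: "sim_on S F G" if "0 < a" "0 < c" "\<And>x. x \<in> S \<Longrightarrow> F x \<le> ennreal a * G x" "\<And>x. x \<in> S \<Longrightarrow> G x \<le> ennreal c * F x"
    for S :: "(real \<Rightarrow> complex) set" and F G a c
  proof -
    have "ennreal (1 / c) * G x \<le> F x" if "x \<in> S" for x
    proof -
      have "ennreal (1 / c) * G x \<le> ennreal (1 / c) * (ennreal c * F x)"
        using that \<open>\<And>x. x \<in> S \<Longrightarrow> G x \<le> ennreal c * F x\<close> by (intro mult_left_mono) auto
      then show ?thesis using \<open>0 < c\<close> by (simp add: inv_mult)
    qed
    moreover have "F x \<le> ennreal (max a (1 / c)) * G x" if "x \<in> S" for x
    proof -
      have "ennreal a * G x \<le> ennreal (max a (1 / c)) * G x"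
        by (intro mult_right_mono ennreal_leI) auto
      then show ?thesis using \<open>\<And>x. x \<in> S \<Longrightarrow> F x \<le> ennreal a * G x\<close>[OF that] by (rule order_trans[rotated])
    qed
    \<comment> \<open>The maximum secures \<open>c \<le> C\<close>, which \<open>sim_on\<close>
      demands.\<close>
    ultimately show ?thesis
      unfolding sim_on_def using that(1,2) by (intro exI[of _ "1 / c"] exI[of _ "max a (1 / c)"]) auto
  qed
  show "sim_on (meas_fun L) (LKnorm L p r b) (\<lambda>f. \<Phi> (rearr L f))"
    using C1 C2 anti by (intro sim_aux[of C1 C2]) (auto simp: LKnorm_def)
  have "0 < L" using L by auto
  have nonneg_cmod: "AE x in ?M. cmod (f x) = Re (f x) \<and> f x = complex_of_real (Re (f x)) \<and> 0 \<le> Re (f x)"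
    if "f \<in> meas_fun_nonneg L" for f
  proof -
    have "AE x in ?M. f x \<in> \<real>\<^sub>\<ge>\<^sub>0" using that by (simp add: meas_fun_nonneg_def)
    then show ?thesis
      by eventually_elim (auto elim!: nonneg_Reals_cases)
  qed
  have sim: "sim_on (meas_fun L) (\<lambda>f. \<Phi> (rearr L f)) (LKnorm L p r b)"
    using C1 C2 anti by (intro sim_aux[of C2 C1]) (auto simp: LKnorm_def)
  have zero: "\<Phi> (rearr L f) = 0 \<longleftrightarrow> (AE x in ?M. f x = 0)" if f: "f \<in> meas_fun L" for f
  proof -
    have "\<Phi> (rearr L f) = 0 \<longleftrightarrow> Bnorm L p r b (rearr L f) = 0"
      using C1(2)[OF anti[of f]] C2(2)[OF anti[of f]] by auto
    also have "\<dots> \<longleftrightarrow> (AE t in ?M. rearr L f t = 0)"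
      by (rule Bnorm_eq_0_iff[OF r b meas])
    also have "\<dots> \<longleftrightarrow> (\<forall>t\<in>?I. rearr L f t = 0)"
    proof
      assume AE: "AE t in ?M. rearr L f t = 0"
      show "\<forall>t\<in>?I. rearr L f t = 0"
      proof
        fix t assume "t \<in> ?I"
        from AE_einterval_ex_less[OF AE this] obtain s where "s < t" "rearr L f s = 0" by auto
        then show "rearr L f t = 0" using rearr_antimono[of s t L f] by simp
      qed
    qed (auto intro: AE_I2)
    also have "\<dots> \<longleftrightarrow> (AE x in ?M. f x = 0)"
      by (rule rearr_eq_0_iff[OF \<open>0 < L\<close> f])
    finally show ?thesis .
  qed
  have apply_rearr: "\<Phi> (rearr L f) = apply_ext L (\<lambda>f. \<Phi> (rearr L f)) (rearr L f)" if f: "f \<in> meas_fun L" for f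
  proof (cases "AE t in ?M. rearr L f t < \<infinity>")
    case True
    have "rearr L f t < \<infinity>" if t: "t \<in> ?I" for t
    proof -
      obtain s where "s < t" "rearr L f s < \<infinity>"
        using AE_einterval_ex_less[OF True t] by auto
      then show ?thesis using rearr_antimono[of s t L f] le_less_trans[of "rearr L f t" "rearr L f s"] by simp
    qed
    then have "rearr L (\<lambda>t. complex_of_real (enn2real (rearr L f t))) = rearr L f"
      using rearr_rearr[OF L f] by blast
    then show ?thesis using True by (simp add: apply_ext_def)
  next
    case False
    \<comment> \<open>Here \<open>apply_ext\<close> takes its default value
      \<open>\<infinity>\<close>, so the functional must be infinite as well: a finite value would
      pass to \<open>Bnorm\<close> and make the rearrangement finite almost everywhere.\<close>
    have "\<not> \<Phi> (rearr L f) < \<infinity>"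
    proof
      assume "\<Phi> (rearr L f) < \<infinity>"
      then have "ennreal C1 * \<Phi> (rearr L f) < \<infinity>" by (simp add: ennreal_mult_less_top)
      then have "Bnorm L p r b (rearr L f) < \<infinity>" using C1(2)[OF anti[of f]] by (rule le_less_trans[rotated])
      then show False using False Bnorm_finite_AE[OF r b meas] by blast
    qed
    then show ?thesis using False by (simp add: apply_ext_def less_top[symmetric])
  qed
  have hom: "\<Phi> (rearr L (\<lambda>x. complex_of_real l * f x)) = ennreal l * \<Phi> (rearr L f)"
    if f: "f \<in> meas_fun L" and "0 \<le> l" for f l
  proof (cases "l = 0")
    \<comment> \<open>\<open>cmult\<close> covers positive factors. For \<open>l = 0\<close> the
      left side vanishes by \<open>zero\<close>, the right side because
      \<open>0 * \<infinity> = 0\<close> in \<open>ennreal\<close>.\<close>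
    case True
    have "(\<lambda>x. 0) \<in> meas_fun L" by (simp add: meas_fun_def)
    from zero[OF this] show ?thesis by (simp add: True)
  next
    case False
    then have "0 < l" using that by simp
    then have "rearr L (\<lambda>x. complex_of_real l * f x) = (\<lambda>t. ennreal l * rearr L f t)"
      using rearr_cmult[OF f] by blast
    then show ?thesis using cmult[OF anti \<open>0 < l\<close>] by simp
  qed
  have monoN: "\<Phi> (rearr L g) \<le> \<Phi> (rearr L f)"
    if fg: "f \<in> meas_fun_nonneg L" "g \<in> meas_fun_nonneg L" "AE x in ?M. Re (g x) \<le> Re (f x)" for f g
  proof (intro mono anti rearr_mono_AE)
    show "f \<in> meas_fun L" "g \<in> meas_fun L" using fg by (auto simp: meas_fun_nonneg_def)
    show "AE x in ?M. cmod (g x) \<le> cmod (f x)"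
      using fg(3) nonneg_cmod[OF fg(1)] nonneg_cmod[OF fg(2)] by eventually_elim auto
  qed
  have triangle: "\<exists>C::real. 1 \<le> C \<and> (\<forall>f\<in>meas_fun L. \<forall>g\<in>meas_fun L.
        \<Phi> (rearr L (\<lambda>x. f x + g x)) \<le> ennreal C * (\<Phi> (rearr L f) + \<Phi> (rearr L g)))"
  proof -
    obtain K :: real where K: "0 < K"
      "\<And>g. g \<in> borel_measurable ?M \<Longrightarrow> Bnorm L p r b (\<lambda>t. g (t / 2)) \<le> ennreal K * Bnorm L p r b g"
      using Bnorm_half_le[OF r b] by blast
    obtain D :: real where D: "1 \<le> D"
      "\<And>g h. g \<in> borel_measurable ?M \<Longrightarrow> h \<in> borel_measurable ?M \<Longrightarrow>
         Bnorm L p r b (\<lambda>t. g t + h t) \<le> ennreal D * (Bnorm L p r b g + Bnorm L p r b h)"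
      using Bnorm_add_le[OF r b] by blast
    \<comment> \<open>Passing from \<open>\<Phi>\<close> to \<open>Bnorm\<close> costs
      \<open>C2\<close>, the quasi-triangle inequality there \<open>D\<close>, the halved argument
      \<open>K\<close>, and the way back \<open>C1\<close>.\<close>
    define C where "C = C2 * (D * (K * C1))"
    have "\<Phi> (rearr L (\<lambda>x. f x + g x)) \<le> ennreal (max 1 C) * (\<Phi> (rearr L f) + \<Phi> (rearr L g))"
      if fg: "f \<in> meas_fun L" "g \<in> meas_fun L" for f g
    proof -
      let ?f = "rearr L f" and ?g = "rearr L g"
      have half: "Bnorm L p r b (\<lambda>t. rearr L f (t / 2)) \<le> ennreal K * (ennreal C1 * \<Phi> (rearr L f))" for f
        using K(2)[OF meas] C1(2)[OF anti] by (meson mult_left_mono order_trans zero_le)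
      have "\<Phi> (rearr L (\<lambda>x. f x + g x)) \<le> ennreal C2 * Bnorm L p r b (rearr L (\<lambda>x. f x + g x))"
        by (rule C2(2)[OF anti])
      also have "Bnorm L p r b (rearr L (\<lambda>x. f x + g x)) \<le> Bnorm L p r b (\<lambda>t. ?f (t / 2) + ?g (t / 2))"
        using einterval_0_subset[of L] by (intro Bnorm_mono r b meas rearr_add_le fg) auto
      also have "\<dots> \<le> ennreal D * (Bnorm L p r b (\<lambda>t. ?f (t / 2)) + Bnorm L p r b (\<lambda>t. ?g (t / 2)))"
        by (intro D(2) measurable_half_einterval meas)
      also have "\<dots> \<le> ennreal D * (ennreal K * (ennreal C1 * \<Phi> ?f) + ennreal K * (ennreal C1 * \<Phi> ?g))"
        by (intro mult_left_mono add_mono half) auto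
      finally have "\<Phi> (rearr L (\<lambda>x. f x + g x)) \<le> ennreal C2 * (ennreal D * (ennreal K * (ennreal C1 * \<Phi> ?f) + ennreal K * (ennreal C1 * \<Phi> ?g)))"
        by (simp add: mult_left_mono)
      also have "\<dots> = ennreal C * (\<Phi> ?f + \<Phi> ?g)"
        using C1 C2 K D by (simp add: C_def ennreal_mult distrib_left mult.assoc)
      also have "\<dots> \<le> ennreal (max 1 C) * (\<Phi> ?f + \<Phi> ?g)"
        by (intro mult_right_mono ennreal_leI) auto
      finally show ?thesis .
    qed
    then show ?thesis by (intro exI[of _ "max 1 C"]) auto
  qed
  have fatou: "\<Phi> (rearr L f) < \<infinity> \<and> incseq (\<lambda>n. \<Phi> (rearr L (F n))) \<and> (\<lambda>n. \<Phi> (rearr L (F n))) \<longlonglongrightarrow> \<Phi> (rearr L f)"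
    if F: "\<And>n. F n \<in> meas_fun_nonneg L" and f: "f \<in> meas_fun_nonneg L"
      and lim: "AE x in ?M. incseq (\<lambda>n. Re (F n x)) \<and> (\<lambda>n. F n x) \<longlonglongrightarrow> f x"
      and fin: "(SUP n. \<Phi> (rearr L (F n))) < \<infinity>" for F :: "nat \<Rightarrow> real \<Rightarrow> complex" and f
  proof -
    have "AE x in ?M. \<forall>n. cmod (F n x) = Re (F n x)"
      unfolding AE_all_countable using nonneg_cmod[OF F] by (auto elim!: eventually_mono)
    with lim have lim': "AE x in ?M. incseq (\<lambda>n. cmod (F n x)) \<and> (\<lambda>n. F n x) \<longlonglongrightarrow> f x"
      by eventually_elim simp
    have F': "F n \<in> meas_fun L" for n using F by (simp add: meas_fun_nonneg_def)
    have inc: "rearr L (F m) t \<le> rearr L (F n) t" if "m \<le> n" for m n t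
      using lim' that by (intro rearr_mono_AE F') (auto simp: incseq_def elim!: eventually_mono)
    have "rearr L f = (\<lambda>t. SUP n. rearr L (F n) t)"
      using f F' lim' by (intro ext rearr_SUP) (auto simp: meas_fun_nonneg_def)
    then have eq: "\<Phi> (rearr L f) = (SUP n. \<Phi> (rearr L (F n)))"
      using SUP[of "\<lambda>n. rearr L (F n)"] anti inc by (simp add: incseq_def)
    have "incseq (\<lambda>n. \<Phi> (rearr L (F n)))"
      using mono[OF anti anti] inc by (simp add: incseq_def)
    then show ?thesis using fin eq LIMSEQ_SUP[of "\<lambda>n. \<Phi> (rearr L (F n))"] by simp
  qed
  have ind: "\<Phi> (rearr L (indicator \<omega>)) < \<infinity>" if \<omega>: "\<omega> \<in> sets lebesgue" "bounded \<omega>" "\<omega> \<subseteq> ?I" for \<omega>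
  proof -
    obtain s where s: "\<And>x. x \<in> \<omega> \<Longrightarrow> x \<le> s"
      using \<omega>(2) by (auto simp: bounded_iff abs_le_iff)
    have "\<Phi> (rearr L (indicator \<omega>)) \<le> ennreal C2 * Bnorm L p r b (rearr L (indicator \<omega>))"
      by (rule C2(2)[OF anti])
    also have "\<dots> \<le> ennreal C2 * Bnorm L p r b (indicator {..<s})"
      using s by (intro mult_left_mono Bnorm_mono r b meas rearr_indicator_le \<omega>) auto
    also have "\<dots> < \<infinity>"
      using Bnorm_indicator_finite[OF L r b nontriv, of s] by (simp add: ennreal_mult_less_top)
    finally show ?thesis .
  qed
  show "equiv_ri_quasinorm L p r b (\<lambda>f. \<Phi> (rearr L f))"
    unfolding equiv_ri_quasinorm_def
  proof (intro conjI)
    show "\<exists>C::real. 1 \<le> C \<and> (\<forall>f\<in>meas_fun_nonneg L. \<forall>g\<in>meas_fun_nonneg L.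
        \<Phi> (rearr L (\<lambda>x. f x + g x)) \<le> ennreal C * (\<Phi> (rearr L f) + \<Phi> (rearr L g)))"
      using triangle by (auto simp: meas_fun_nonneg_def)
    show "\<forall>F f. (\<forall>n::nat. F n \<in> meas_fun_nonneg L) \<longrightarrow> f \<in> meas_fun_nonneg L \<longrightarrow>
        (AE x in ?M. incseq (\<lambda>n. Re (F n x)) \<and> (\<lambda>n. F n x) \<longlonglongrightarrow> f x) \<longrightarrow>
        (SUP n. \<Phi> (rearr L (F n))) < \<infinity> \<longrightarrow>
        \<Phi> (rearr L f) < \<infinity> \<and> incseq (\<lambda>n. \<Phi> (rearr L (F n))) \<and>
        (\<lambda>n. \<Phi> (rearr L (F n))) \<longlonglongrightarrow> \<Phi> (rearr L f)"
      using fatou by blast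
  qed (use sim apply_rearr zero hom monoN ind in \<open>auto simp: meas_fun_nonneg_def\<close>)
qed

section \<open>Averaging operators\<close>

definition averaging_op ::
  "(real \<Rightarrow> real set) \<Rightarrow> real \<Rightarrow> ereal \<Rightarrow> (real \<Rightarrow> real) \<Rightarrow> (real \<Rightarrow> ennreal) \<Rightarrow> real \<Rightarrow> ennreal" where
  "averaging_op A a W d g t =
     ennreal (inverse (t powr a * d t)) * Lnorm W (A t) (\<lambda>v. ennreal (v powr (a - rcp W) * d v) * g v)"

lemma avg_head_eq: "avg_head L U W d f = averaging_op (\<lambda>t. einterval 0 (ereal t)) (rcp U) W d (rearr L f)"
  by (simp add: fun_eq_iff avg_head_def averaging_op_def)

lemma avg_tail_eq: "avg_tail L V W d f = averaging_op (\<lambda>t. einterval (ereal t) L) (rcp V) W d (rearr L f)"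
  by (simp add: fun_eq_iff avg_tail_def averaging_op_def)

text \<open>
  The sets \<open>A t\<close> are the intervals \<open>(0,t)\<close> or \<open>(t,L)\<close>; the last condition, used with
  \<open>x = 1/p - 1/U\<close> and \<open>x = 1/p - 1/V\<close>, is where the assumptions \<open>U < p\<close> and \<open>p < V\<close> enter.
\<close>

definition averaging_family :: "ereal \<Rightarrow> (real \<Rightarrow> real set) \<Rightarrow> real \<Rightarrow> real \<Rightarrow> bool" where
  "averaging_family L A x \<eta> \<longleftrightarrow>
     (\<forall>t. A t \<in> sets lebesgue) \<and>
     (\<forall>t\<in>einterval 0 L. A t \<subseteq> einterval 0 L) \<and>
     (mono_on (einterval 0 L) A \<or> antimono_on (einterval 0 L) A) \<and>
     (\<forall>t\<in>einterval 0 L. 2 * t \<in> einterval 0 L \<longrightarrow> {t/2<..<t} \<subseteq> A t \<or> {t<..<2 * t} \<subseteq> A t) \<and>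
     (\<forall>t\<in>einterval 0 L. \<forall>v\<in>A t. t powr x \<le> ratio_kernel \<eta> t v * v powr x)"

lemma averaging_family_sets: "averaging_family L A x \<eta> \<Longrightarrow> A t \<in> sets lebesgue"
  by (simp add: averaging_family_def)

lemma averaging_family_subset: "averaging_family L A x \<eta> \<Longrightarrow> t \<in> einterval 0 L \<Longrightarrow> A t \<subseteq> einterval 0 L"
  by (simp add: averaging_family_def)

lemma averaging_family_monotone:
  "averaging_family L A x \<eta> \<Longrightarrow> mono_on (einterval 0 L) A \<or> antimono_on (einterval 0 L) A"
  by (simp add: averaging_family_def)

lemma averaging_family_half:
  "averaging_family L A x \<eta> \<Longrightarrow> t \<in> einterval 0 L \<Longrightarrow> 2 * t \<in> einterval 0 L \<Longrightarrow>
     {t/2<..<t} \<subseteq> A t \<or> {t<..<2 * t} \<subseteq> A t"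
  by (simp add: averaging_family_def)

lemma averaging_family_decay:
  "averaging_family L A x \<eta> \<Longrightarrow> t \<in> einterval 0 L \<Longrightarrow> v \<in> A t \<Longrightarrow>
     t powr x \<le> ratio_kernel \<eta> t v * v powr x"
  by (simp add: averaging_family_def)

lemma einterval_0_pos: "t \<in> einterval 0 L \<Longrightarrow> 0 < t"
  using einterval_0_subset by auto

lemma slowly_varying_weight_pos:
  "d \<in> slowly_varying L \<Longrightarrow> t \<in> einterval 0 L \<Longrightarrow> 0 < t powr y * d t"
  using slowly_varying_pos einterval_0_pos by (metis mult_pos_pos powr_gt_zero less_irrefl)

section \<open>Measurability, homogeneity and monotone continuity of averages\<close>

lemma integrand_measurable_on:
  assumes d: "d \<in> slowly_varying L" and A: "averaging_family L A x \<eta>"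
    and g: "g \<in> borel_measurable (lebesgue_on (einterval 0 L))" and t: "t \<in> einterval 0 L"
  shows "(\<lambda>v. ennreal (v powr y * d v) * g v) \<in> borel_measurable (lebesgue_on (A t))"
  using measurable_restrict_mono[OF Bnorm_measurable[OF d g] averaging_family_subset[OF A t]] .

text \<open>The domain of the inner norm moves with \<open>t\<close>. Since the family is monotone,
  the norm is a monotone function of \<open>t\<close> and hence measurable.\<close>

lemma averaging_op_measurable:
  assumes W: "0 < W" and d: "d \<in> slowly_varying L" and A: "averaging_family L A x \<eta>"
    and g: "g \<in> borel_measurable (lebesgue_on (einterval 0 L))"
  shows "averaging_op A a W d g \<in> borel_measurable (lebesgue_on (einterval 0 L))"
proof -
  have [measurable]: "d \<in> borel_measurable (lebesgue_on (einterval 0 L))" by (rule slowly_varying_measurable[OF d])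
  let ?N = "\<lambda>t. Lnorm W (A t) (\<lambda>v. ennreal (v powr (a - rcp W) * d v) * g v)"
  have le: "?N s \<le> ?N t" if "A s \<subseteq> A t" "t \<in> einterval 0 L" for s t
    using that by (intro Lnorm_subset_le W averaging_family_sets[OF A] integrand_measurable_on[OF d A] g)
  from averaging_family_monotone[OF A] have [measurable]: "?N \<in> borel_measurable (lebesgue_on (einterval 0 L))"
  proof
    assume "mono_on (einterval 0 L) A"
    then show ?thesis by (intro measurable_mono_on monotone_onI le) (auto simp: monotone_on_def)
  next
    assume "antimono_on (einterval 0 L) A"
    then show ?thesis by (intro measurable_antimono_on monotone_onI le) (auto simp: monotone_on_def)
  qed
  have "(\<lambda>t. ennreal (inverse (t powr a * d t)) * ?N t) \<in> borel_measurable (lebesgue_on (einterval 0 L))"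
    by measurable
  then show ?thesis by (simp add: averaging_op_def[abs_def])
qed

lemma averaging_op_cmult:
  assumes W: "0 < W" and d: "d \<in> slowly_varying L" and A: "averaging_family L A x \<eta>"
    and g: "g \<in> borel_measurable (lebesgue_on (einterval 0 L))" and c: "0 < c" and t: "t \<in> einterval 0 L"
  shows "averaging_op A a W d (\<lambda>v. ennreal c * g v) t = ennreal c * averaging_op A a W d g t"
  using Lnorm_cmult[OF W integrand_measurable_on[OF d A g t, of "a - rcp W"] c]
  by (simp add: averaging_op_def mult.left_commute)

lemma averaging_op_mono:
  assumes W: "0 < W" and d: "d \<in> slowly_varying L" and A: "averaging_family L A x \<eta>"
    and g: "g \<in> borel_measurable (lebesgue_on (einterval 0 L))"
    and le: "\<And>v. v \<in> einterval 0 L \<Longrightarrow> g v \<le> h v" and t: "t \<in> einterval 0 L"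
  shows "averaging_op A a W d g t \<le> averaging_op A a W d h t"
  unfolding averaging_op_def using averaging_family_subset[OF A t]
  by (intro mult_left_mono Lnorm_mono W integrand_measurable_on[OF d A g t] le) auto

lemma averaging_op_SUP:
  assumes W: "0 < W" and d: "d \<in> slowly_varying L" and A: "averaging_family L A x \<eta>"
    and g: "\<And>n::nat. g n \<in> borel_measurable (lebesgue_on (einterval 0 L))"
    and inc: "\<And>v. v \<in> einterval 0 L \<Longrightarrow> incseq (\<lambda>n. g n v)" and t: "t \<in> einterval 0 L"
  shows "averaging_op A a W d (\<lambda>v. SUP n. g n v) t = (SUP n. averaging_op A a W d (g n) t)"
proof -
  have "Lnorm W (A t) (\<lambda>v. ennreal (v powr (a - rcp W) * d v) * (SUP n. g n v))
     = Lnorm W (A t) (\<lambda>v. SUP n. ennreal (v powr (a - rcp W) * d v) * g n v)"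
    by (simp add: SUP_mult_left_ennreal)
  also have "\<dots> = (SUP n. Lnorm W (A t) (\<lambda>v. ennreal (v powr (a - rcp W) * d v) * g n v))"
  proof (intro Lnorm_SUP W integrand_measurable_on[OF d A g t])
    fix v assume "v \<in> A t"
    then have "incseq (\<lambda>n. g n v)" using averaging_family_subset[OF A t] inc by auto
    then show "incseq (\<lambda>n. ennreal (v powr (a - rcp W) * d v) * g n v)"
      by (auto simp: incseq_def intro: mult_left_mono)
  qed
  finally show ?thesis
    by (simp add: averaging_op_def SUP_mult_left_ennreal)
qed

lemma Bnorm_cong:
  "0 < r \<Longrightarrow> (\<And>t. t \<in> einterval 0 L \<Longrightarrow> g t = h t) \<Longrightarrow> Bnorm L p r b g = Bnorm L p r b h"
  unfolding Bnorm_def by (intro Lnorm_cong) auto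

text \<open>The average at \<open>t\<close> itself need not control \<open>g t\<close>: for the tail
  operator it is taken to the right of \<open>t\<close>, where \<open>g\<close> may vanish. At
  \<open>s = t / 2\<close> both \<open>(s/2, s)\<close> and \<open>(s, 2 s)\<close> lie to the left
  of \<open>t\<close>, where \<open>g\<close> is at least \<open>g t\<close>, and
  \<open>2 s = t\<close> does not leave \<open>(0,L)\<close>.\<close>

lemma antimono_le_averaging_op_half:
  assumes W: "0 < W" and d: "d \<in> slowly_varying L" and A: "averaging_family L A x \<eta>"
  obtains C where "0 < C" "\<And>g t. antimono_on (einterval 0 L) g \<Longrightarrow> t \<in> einterval 0 L \<Longrightarrow> g t \<le> ennreal C * averaging_op A a W d g (t / 2)"
proof -
  obtain K where K: "0 < K" "\<And>s t. s \<in> einterval 0 L \<Longrightarrow> t \<in> einterval 0 L \<Longrightarrow> s \<le> 2 * t \<Longrightarrow> t \<le> 2 * s \<Longrightarrow>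
    s powr a * d s \<le> K * (t powr a * d t)"
    using slowly_varying_doubling[OF d, of a] by blast
  show ?thesis
  proof (rule that[of "K * 2 powr rcp W"])
    show "0 < K * 2 powr rcp W" using K by simp
    fix g :: "real \<Rightarrow> ennreal" and t assume g: "antimono_on (einterval 0 L) g" and t: "t \<in> einterval 0 L"
    define s where "s = t / 2"
    have s: "s \<in> einterval 0 L" "0 < s" "t = 2 * s"
      using einterval_0_down[OF t, of s] einterval_0_pos[OF t] by (auto simp: s_def)
    \<comment> \<open>The second interval is written with left end \<open>2 * s / 2\<close> so that
      both have the form \<open>(v/2, v)\<close>.\<close>
    have "{s/2<..<s} \<subseteq> A s \<or> {2 * s / 2<..<2 * s} \<subseteq> A s"
      using averaging_family_half[OF A, of s] s t by simp
    then obtain v where v: "{v/2<..<v} \<subseteq> A s" "v = s \<or> v = 2 * s" by blast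
    have gm: "g \<in> borel_measurable (lebesgue_on (einterval 0 L))" by (rule measurable_antimono_on[OF g])
    have pos: "0 < s powr a * d s" by (rule slowly_varying_weight_pos[OF d s(1)])
    have le: "ennreal (s powr a * d s) * g t \<le> ennreal K * (ennreal (u powr a * d u) * g u)"
      if "v / 2 < u" "u < v" for u
    proof -
      have u: "u \<in> A s" "u \<in> einterval 0 L" using v(1) that averaging_family_subset[OF A s(1)] by auto
      have us: "u \<le> 2 * s" "s \<le> 2 * u" using v(2) that s by auto
      have "ennreal (s powr a * d s) \<le> ennreal (K * (u powr a * d u))"
        using K(2)[OF s(1) u(2) us(2) us(1)] by (rule ennreal_leI)
      moreover have "g t \<le> g u"
        using monotone_onD[OF g u(2) t] us s by auto
      ultimately have "ennreal (s powr a * d s) * g t \<le> ennreal (K * (u powr a * d u)) * g u"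
        by (rule mult_mono) auto
      then show ?thesis
        using K slowly_varying_weight_pos[OF d u(2), of a] by (simp add: ennreal_mult mult.assoc)
    qed
    have "ennreal (s powr a * d s) * g t
        \<le> ennreal (K * 2 powr rcp W) * Lnorm W (A s) (\<lambda>u. ennreal (u powr (- rcp W)) * (ennreal (u powr a * d u) * g u))"
      using v s K le by (intro le_Lnorm_half_interval[where v = v] W averaging_family_sets[OF A] integrand_measurable_on[OF d A] gm) auto
    also have "Lnorm W (A s) (\<lambda>u. ennreal (u powr (- rcp W)) * (ennreal (u powr a * d u) * g u))
        = Lnorm W (A s) (\<lambda>u. ennreal (u powr (a - rcp W) * d u) * g u)"
    proof (rule Lnorm_cong[OF W])
      fix u assume "u \<in> A s"
      then have "0 < d u" using averaging_family_subset[OF A s(1)] slowly_varying_pos[OF d] by auto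
      moreover have "u powr (- rcp W) * (u powr a * d u) = u powr (a - rcp W) * d u"
        by (simp add: powr_diff powr_minus divide_inverse)
      ultimately show "ennreal (u powr (- rcp W)) * (ennreal (u powr a * d u) * g u) = ennreal (u powr (a - rcp W) * d u) * g u"
        by (simp flip: mult.assoc ennreal_mult)
    qed
    finally have "ennreal (inverse (s powr a * d s)) * (ennreal (s powr a * d s) * g t) \<le> ennreal (K * 2 powr rcp W) * averaging_op A a W d g s"
      unfolding averaging_op_def mult.left_commute[of "ennreal (K * 2 powr rcp W)"]
      by (intro mult_left_mono) auto
    moreover have "ennreal (inverse (s powr a * d s)) * (ennreal (s powr a * d s) * g t) = g t"
    proof -
      have "ennreal (inverse x) * ennreal x = 1" if "0 < x" for x
        using that by (simp flip: ennreal_mult)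
      from this[OF pos] show ?thesis by (simp only: mult_1_left flip: mult.assoc)
    qed
    ultimately show "g t \<le> ennreal (K * 2 powr rcp W) * averaging_op A a W d g (t / 2)"
      by (simp add: s_def)
  qed
qed

lemma Bnorm_le_Bnorm_averaging_op:
  assumes r: "0 < r" and W: "0 < W" and b: "b \<in> slowly_varying L" and d: "d \<in> slowly_varying L"
    and A: "averaging_family L A x \<eta>"
  obtains C where "0 < C" "\<And>g. antimono_on (einterval 0 L) g \<Longrightarrow> Bnorm L p r b g \<le> ennreal C * Bnorm L p r b (averaging_op A a W d g)"
proof -
  obtain C where C: "0 < C" "\<And>g t. antimono_on (einterval 0 L) g \<Longrightarrow> t \<in> einterval 0 L \<Longrightarrow> g t \<le> ennreal C * averaging_op A a W d g (t / 2)"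
    using antimono_le_averaging_op_half[OF W d A] by blast
  obtain D :: real where D: "0 < D"
    "\<And>g. g \<in> borel_measurable (lebesgue_on (einterval 0 L)) \<Longrightarrow> Bnorm L p r b (\<lambda>t. g (t / 2)) \<le> ennreal D * Bnorm L p r b g"
    using Bnorm_half_le[OF r b] by blast
  show ?thesis
  proof (rule that[of "C * D"])
    show "0 < C * D" using C D by simp
    fix g :: "real \<Rightarrow> ennreal" assume g: "antimono_on (einterval 0 L) g"
    have gm: "g \<in> borel_measurable (lebesgue_on (einterval 0 L))" by (rule measurable_antimono_on[OF g])
    have "Bnorm L p r b g \<le> Bnorm L p r b (\<lambda>t. ennreal C * averaging_op A a W d g (t / 2))"
      using C(2)[OF g] by (intro Bnorm_mono r b gm) auto
    also have "\<dots> = ennreal C * Bnorm L p r b (\<lambda>t. averaging_op A a W d g (t / 2))"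
      by (intro Bnorm_cmult r b measurable_half_einterval averaging_op_measurable[OF W d A] gm C)
    also have "\<dots> \<le> ennreal C * (ennreal D * Bnorm L p r b (averaging_op A a W d g))"
      by (intro mult_left_mono D averaging_op_measurable[OF W d A] gm) auto
    finally show "Bnorm L p r b g \<le> ennreal (C * D) * Bnorm L p r b (averaging_op A a W d g)"
      using C D by (simp add: ennreal_mult mult.assoc)
  qed
qed

text \<open>Half of the decay \<open>ratio_kernel \<eta>\<close> absorbs the slow variation of \<open>b\<close> and \<open>d\<close>.\<close>

lemma weight_quotient_le:
  assumes b: "b \<in> slowly_varying L" and d: "d \<in> slowly_varying L"
    and \<eta>: "0 < \<eta>" and A: "averaging_family L A (rcp p - a) \<eta>"
  obtains K where "0 < K" "\<And>t v. t \<in> einterval 0 L \<Longrightarrow> v \<in> A t \<Longrightarrow>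
    t powr rcp p * b t * inverse (t powr a * d t) * (v powr a * d v)
      \<le> K * (ratio_kernel (\<eta> / 2) t v * (v powr rcp p * b v))"
proof -
  obtain K where K: "0 < K" "\<And>s t. s \<in> einterval 0 L \<Longrightarrow> t \<in> einterval 0 L \<Longrightarrow> ratio_kernel (\<eta> / 4) s t * b s \<le> K * b t"
    using slowly_varying_ratio[OF b, of "\<eta> / 4"] \<eta> by auto
  obtain K' where K': "0 < K'" "\<And>s t. s \<in> einterval 0 L \<Longrightarrow> t \<in> einterval 0 L \<Longrightarrow> ratio_kernel (\<eta> / 4) s t * d s \<le> K' * d t"
    using slowly_varying_ratio[OF d, of "\<eta> / 4"] \<eta> by auto
  show ?thesis
  proof (rule that[of "K * K'"])
    show "0 < K * K'" using K K' by simp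
    fix t v assume t: "t \<in> einterval 0 L" and v: "v \<in> A t"
    then have vI: "v \<in> einterval 0 L" using averaging_family_subset[OF A] by auto
    have pos: "0 < t" "0 < v" "0 < d t" "0 < d v" "0 < b t" "0 < b v"
      using t vI einterval_0_pos slowly_varying_pos[OF b] slowly_varying_pos[OF d] by auto
    let ?k = "\<lambda>e. ratio_kernel e t v"
    \<comment> \<open>A quarter of the exponent is spent on each of \<open>b\<close> and
      \<open>d\<close>; the remaining half survives.\<close>
    have k: "?k \<eta> = ?k (\<eta> / 2) * ?k (\<eta> / 4) * ?k (\<eta> / 4)"
      by (simp flip: ratio_kernel_add)
    \<comment> \<open>The quotient compares \<open>b\<close> at \<open>t\<close> with
      \<open>v\<close>, but \<open>d\<close> at \<open>v\<close> with \<open>t\<close>; the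
      symmetric kernel controls both directions.\<close>
    have "?k (\<eta> / 4) * b t \<le> K * b v" using K(2)[OF t vI] .
    moreover have "?k (\<eta> / 4) * d v / d t \<le> K'"
      using K'(2)[OF vI t] pos by (simp add: ratio_kernel_commute[of _ v] pos_divide_le_eq)
    ultimately have "(?k (\<eta> / 4) * b t) * (?k (\<eta> / 4) * d v / d t) \<le> (K * b v) * K'"
      by (rule mult_mono) (use pos K K' in auto)
    then have 1: "?k (\<eta> / 2) * v powr rcp p * ((?k (\<eta> / 4) * b t) * (?k (\<eta> / 4) * d v / d t))
        \<le> ?k (\<eta> / 2) * v powr rcp p * ((K * b v) * K')"
      by (intro mult_left_mono) auto
    have "t powr rcp p * b t * inverse (t powr a * d t) * (v powr a * d v)
        = t powr (rcp p - a) * (v powr a * b t * d v / d t)"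
      by (simp add: powr_diff field_simps)
    \<comment> \<open>The powers of \<open>t\<close> have combined to exponent
      \<open>rcp p - a\<close>, the one for which the family provides decay.\<close>
    also have "\<dots> \<le> (?k \<eta> * v powr (rcp p - a)) * (v powr a * b t * d v / d t)"
      using averaging_family_decay[OF A t v] pos by (intro mult_right_mono) auto
    also have "\<dots> = ?k (\<eta> / 2) * v powr rcp p * ((?k (\<eta> / 4) * b t) * (?k (\<eta> / 4) * d v / d t))"
      using pos by (simp add: k powr_diff mult_ac)
    also note 1
    finally show "t powr rcp p * b t * inverse (t powr a * d t) * (v powr a * d v)
      \<le> K * K' * (?k (\<eta> / 2) * (v powr rcp p * b v))"
      by (simp add: mult_ac)
  qed
qed

text \<open>On \<open>(v/2, v)\<close> the kernel is smaller than at \<open>v\<close> by at most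
  \<open>2 powr e\<close>, the weight by at most a doubling constant, and \<open>g\<close> is at
  least \<open>g v\<close>. Hence a value at one point is controlled by a norm with the outer
  exponent, whatever that exponent is.\<close>

lemma kernel_weight_le_Lnorm:
  assumes r: "0 < r" and b: "b \<in> slowly_varying L" and "0 < e"
  obtains C where "0 < C" "\<And>g t v. antimono_on (einterval 0 L) g \<Longrightarrow> t \<in> einterval 0 L \<Longrightarrow> v \<in> einterval 0 L \<Longrightarrow>
    ennreal (ratio_kernel e t v) * (ennreal (v powr rcp p * b v) * g v)
      \<le> ennreal C * Lnorm r (einterval 0 L) (\<lambda>u. ennreal (ratio_kernel e t u * u powr (- rcp r)) * (ennreal (u powr rcp p * b u) * g u))"
proof -
  obtain K where K: "0 < K" "\<And>s t. s \<in> einterval 0 L \<Longrightarrow> t \<in> einterval 0 L \<Longrightarrow> s \<le> 2 * t \<Longrightarrow> t \<le> 2 * s \<Longrightarrow>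
    s powr rcp p * b s \<le> K * (t powr rcp p * b t)"
    using slowly_varying_doubling[OF b, of "rcp p"] by blast
  show ?thesis
  proof (rule that[of "2 powr e * K * 2 powr rcp r"])
    show "0 < 2 powr e * K * 2 powr rcp r" using K by simp
    fix g :: "real \<Rightarrow> ennreal" and t v assume g: "antimono_on (einterval 0 L) g" and t: "t \<in> einterval 0 L" and v: "v \<in> einterval 0 L"
    let ?w = "\<lambda>u. u powr rcp p * b u" and ?k = "ratio_kernel e t"
    have [measurable]: "b \<in> borel_measurable (lebesgue_on (einterval 0 L))" "g \<in> borel_measurable (lebesgue_on (einterval 0 L))"
      by (rule slowly_varying_measurable[OF b], rule measurable_antimono_on[OF g])
    have uI: "u \<in> einterval 0 L" if "v / 2 < u" "u < v" for u
      using einterval_0_down[OF v, of u] that einterval_0_pos[OF v] by auto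
    have le: "ennreal (?k v) * (ennreal (?w v) * g v) \<le> ennreal (2 powr e * K) * (ennreal (?k u) * (ennreal (?w u) * g u))"
      if u: "v / 2 < u" "u < v" for u
    proof -
      have w: "0 < ?w u" "0 < ?w v" using slowly_varying_weight_pos[OF b] uI[OF u] v by auto
      have "?k v \<le> 2 powr e * ?k u"
        using ratio_kernel_half[of e t v u] u assms einterval_0_pos[OF t] einterval_0_pos[OF v] by auto
      moreover have "?w v \<le> K * ?w u"
        using K(2)[OF v uI[OF u]] u einterval_0_pos[OF v] by auto
      ultimately have "?k v * ?w v \<le> (2 powr e * ?k u) * (K * ?w u)"
        by (rule mult_mono) (use w in auto)
      then have "ennreal (?k v * ?w v) \<le> ennreal ((2 powr e * K) * (?k u * ?w u))"
        by (intro ennreal_leI) (simp add: mult_ac)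
      moreover have "g v \<le> g u" using monotone_onD[OF g uI[OF u] v] u by auto
      ultimately have "ennreal (?k v * ?w v) * g v \<le> ennreal ((2 powr e * K) * (?k u * ?w u)) * g u"
        by (rule mult_mono) auto
      then show ?thesis using w K by (simp add: ennreal_mult mult.assoc)
    qed
    have "ennreal (?k v) * (ennreal (?w v) * g v)
        \<le> ennreal (2 powr e * K * 2 powr rcp r) *
            Lnorm r (einterval 0 L) (\<lambda>u. ennreal (u powr (- rcp r)) * (ennreal (?k u) * (ennreal (?w u) * g u)))"
      using K le uI einterval_0_pos[OF v] by (intro le_Lnorm_half_interval[where v = v] r) auto
    also have "(\<lambda>u. ennreal (u powr (- rcp r)) * (ennreal (?k u) * (ennreal (?w u) * g u)))
       = (\<lambda>u. ennreal (?k u * u powr (- rcp r)) * (ennreal (?w u) * g u))"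
      by (simp add: ennreal_mult mult_ac)
    finally show "ennreal (?k v) * (ennreal (?w v) * g v)
      \<le> ennreal (2 powr e * K * 2 powr rcp r) * Lnorm r (einterval 0 L) (\<lambda>u. ennreal (?k u * u powr (- rcp r)) * (ennreal (?w u) * g u))" .
  qed
qed

lemma Bnorm_averaging_op_le_Bnorm:
  assumes r: "0 < r" and W: "0 < W"
    and b: "b \<in> slowly_varying L" and d: "d \<in> slowly_varying L" and \<eta>: "0 < \<eta>"
    and A: "averaging_family L A (rcp p - a) \<eta>"
  obtains C where "0 < C" "\<And>g. antimono_on (einterval 0 L) g \<Longrightarrow> Bnorm L p r b (averaging_op A a W d g) \<le> ennreal C * Bnorm L p r b g"
proof -
  \<comment> \<open>The surviving exponent \<open>\<eta> / 2\<close> is split into two equal parts,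
    one for the inner norm and one for the convolution.\<close>
  define e where "e = \<eta> / 4"
  have e: "0 < e" using \<eta> by (simp add: e_def)
  obtain K where K: "0 < K" "\<And>t v. t \<in> einterval 0 L \<Longrightarrow> v \<in> A t \<Longrightarrow>
    t powr rcp p * b t * inverse (t powr a * d t) * (v powr a * d v)
      \<le> K * (ratio_kernel (\<eta> / 2) t v * (v powr rcp p * b v))"
    using weight_quotient_le[OF b d \<eta> A] by blast
  obtain C where C: "0 < C" "\<And>g t v. antimono_on (einterval 0 L) g \<Longrightarrow> t \<in> einterval 0 L \<Longrightarrow> v \<in> einterval 0 L \<Longrightarrow>
    ennreal (ratio_kernel e t v) * (ennreal (v powr rcp p * b v) * g v)
      \<le> ennreal C * Lnorm r (einterval 0 L) (\<lambda>u. ennreal (ratio_kernel e t u * u powr (- rcp r)) * (ennreal (u powr rcp p * b u) * g u))"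
    using kernel_weight_le_Lnorm[OF r b e] by blast
  obtain D where D: "0 < D" "\<And>A t. A \<in> sets lebesgue \<Longrightarrow> A \<subseteq> {0<..} \<Longrightarrow> 0 < t \<Longrightarrow>
       Lnorm W A (\<lambda>v. ennreal (ratio_kernel e t v * v powr (- rcp W))) \<le> ennreal D"
    using Lnorm_ratio_kernel_le[OF W e] by blast
  obtain E where E: "0 < E"
    "\<And>A h F. A \<in> sets lebesgue \<Longrightarrow> A \<subseteq> {0<..} \<Longrightarrow> h \<in> borel_measurable (lebesgue_on A) \<Longrightarrow>
       F \<in> borel_measurable (lebesgue_on A) \<Longrightarrow>
       (\<And>t. t \<in> A \<Longrightarrow> F t \<le> ennreal (t powr (- rcp r)) *
           Lnorm r A (\<lambda>u. ennreal (ratio_kernel e t u * u powr (- rcp r)) * h u)) \<Longrightarrow>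
       Lnorm r A F \<le> ennreal E * Lnorm r A (\<lambda>u. ennreal (u powr (- rcp r)) * h u)"
    using Lnorm_ratio_kernel_convolution[OF r e] by blast
  show ?thesis
  proof (rule that[of "E * (K * C * D)"])
    show "0 < E * (K * C * D)" using K C D E by simp
    fix g :: "real \<Rightarrow> ennreal" assume g: "antimono_on (einterval 0 L) g"
    have gm [measurable]: "g \<in> borel_measurable (lebesgue_on (einterval 0 L))" by (rule measurable_antimono_on[OF g])
    have [measurable]: "b \<in> borel_measurable (lebesgue_on (einterval 0 L))" by (rule slowly_varying_measurable[OF b])
    let ?w = "\<lambda>u. u powr rcp p * b u"
    let ?h = "\<lambda>u. ennreal (?w u) * g u"
    let ?S = "\<lambda>t. Lnorm r (einterval 0 L) (\<lambda>u. ennreal (ratio_kernel e t u * u powr (- rcp r)) * ?h u)"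
    \<comment> \<open>All constants are moved into the function, since the convolution estimate asks
      for a pointwise bound without a constant.\<close>
    let ?h' = "\<lambda>u. ennreal (K * C * D) * ?h u"
    let ?F = "\<lambda>t. ennreal (t powr (rcp p - rcp r) * b t) * averaging_op A a W d g t"
    have bound: "?F t \<le> ennreal (t powr (- rcp r)) *
           Lnorm r (einterval 0 L) (\<lambda>u. ennreal (ratio_kernel e t u * u powr (- rcp r)) * ?h' u)" if t: "t \<in> einterval 0 L" for t
    proof -
      \<comment> \<open>\<open>q\<close> collects the factors depending on \<open>t\<close> alone,
        except \<open>t powr (- rcp r)\<close>, which must stay outside for the convolution
        estimate.\<close>
      define q where "q = ?w t * inverse (t powr a * d t)"
      have q: "0 < q"
        unfolding q_def by (intro mult_pos_pos slowly_varying_weight_pos[OF b t] slowly_varying_weight_pos[OF d t] positive_imp_inverse_positive)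
      let ?X = "\<lambda>v. ennreal (v powr (a - rcp W) * d v) * g v"
      have "ennreal q * Lnorm W (A t) ?X = Lnorm W (A t) (\<lambda>v. ennreal q * ?X v)"
        using q t by (intro Lnorm_cmult[symmetric] W integrand_measurable_on[OF d A] gm)
      also have "\<dots> \<le> Lnorm W (A t) (\<lambda>v. (ennreal (K * C) * ?S t) * ennreal (ratio_kernel e t v * v powr (- rcp W)))"
      proof (intro Lnorm_mono W)
        show "(\<lambda>v. ennreal q * ?X v) \<in> borel_measurable (lebesgue_on (A t))"
          using integrand_measurable_on[OF d A gm t] by measurable
        fix v assume v: "v \<in> A t"
        then have vI: "v \<in> einterval 0 L" using averaging_family_subset[OF A] t by auto
        have wv: "0 < ?w v" by (rule slowly_varying_weight_pos[OF b vI])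
        have "q * (v powr (a - rcp W) * d v) = (q * (v powr a * d v)) * v powr (- rcp W)"
          by (simp add: powr_diff powr_minus divide_inverse)
        also have "\<dots> \<le> (K * (ratio_kernel (\<eta> / 2) t v * ?w v)) * v powr (- rcp W)"
          using K(2)[OF t v] by (intro mult_right_mono) (auto simp: q_def)
        also have "ratio_kernel (\<eta> / 2) t v = ratio_kernel e t v * ratio_kernel e t v"
          by (simp add: e_def flip: ratio_kernel_add)
        finally have "q * (v powr (a - rcp W) * d v)
            \<le> K * (ratio_kernel e t v * v powr (- rcp W)) * (ratio_kernel e t v * ?w v)"
          by (simp add: mult_ac)
        then have "ennreal (q * (v powr (a - rcp W) * d v)) * g v
            \<le> ennreal (K * (ratio_kernel e t v * v powr (- rcp W)) * (ratio_kernel e t v * ?w v)) * g v"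
          by (intro mult_right_mono ennreal_leI) auto
        then have "ennreal q * ?X v \<le> ennreal K * ennreal (ratio_kernel e t v * v powr (- rcp W)) *
            (ennreal (ratio_kernel e t v) * ?h v)"
          using q K slowly_varying_pos[OF b vI] slowly_varying_pos[OF d vI]
          by (simp add: ennreal_mult mult.assoc)
        also have "\<dots> \<le> ennreal K * ennreal (ratio_kernel e t v * v powr (- rcp W)) * (ennreal C * ?S t)"
          by (intro mult_left_mono C(2)[OF g t vI]) auto
        finally show "ennreal q * ?X v \<le> (ennreal (K * C) * ?S t) * ennreal (ratio_kernel e t v * v powr (- rcp W))"
          using K C by (simp add: ennreal_mult mult_ac)
      qed
      \<comment> \<open>\<open>?S t\<close> may be infinite, so the factor is taken out by the
        inequality valid for all extended constants.\<close>
      also have "\<dots> \<le> (ennreal (K * C) * ?S t) * Lnorm W (A t) (\<lambda>v. ennreal (ratio_kernel e t v * v powr (- rcp W)))"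
        by (intro Lnorm_cmult_le W) measurable
      also have "\<dots> \<le> (ennreal (K * C) * ?S t) * ennreal D"
        using averaging_family_subset[OF A t] einterval_0_subset[of L] einterval_0_pos[OF t] by (intro mult_left_mono D averaging_family_sets[OF A]) auto
      also have "\<dots> = ennreal (K * C * D) * ?S t"
        using K C D by (simp add: ennreal_mult mult_ac)
      also have "\<dots> = Lnorm r (einterval 0 L) (\<lambda>u. ennreal (K * C * D) * (ennreal (ratio_kernel e t u * u powr (- rcp r)) * ?h u))"
        using K C D by (intro Lnorm_cmult[symmetric] r) auto
      finally have "ennreal (t powr (- rcp r)) * (ennreal q * Lnorm W (A t) ?X)
          \<le> ennreal (t powr (- rcp r)) * Lnorm r (einterval 0 L) (\<lambda>u. ennreal (ratio_kernel e t u * u powr (- rcp r)) * ?h' u)"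
        by (intro mult_left_mono) (simp_all add: mult.left_commute)
      moreover have "?F t = ennreal (t powr (- rcp r)) * (ennreal q * Lnorm W (A t) ?X)"
      proof -
        have "ennreal (t powr (rcp p - rcp r) * b t) * ennreal (inverse (t powr a * d t)) = ennreal (t powr (- rcp r)) * ennreal q"
        proof -
          have "t powr (rcp p - rcp r) * b t * inverse (t powr a * d t) = t powr (- rcp r) * q"
            by (simp add: q_def powr_diff powr_minus divide_inverse)
          then show ?thesis
            using slowly_varying_pos[OF b t] slowly_varying_pos[OF d t] q by (simp flip: ennreal_mult)
        qed
        then show ?thesis by (simp add: averaging_op_def flip: mult.assoc)
      qed
      ultimately show ?thesis by simp
    qed
    have "Bnorm L p r b (averaging_op A a W d g) = Lnorm r (einterval 0 L) ?F" by (simp add: Bnorm_def)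
    also have "\<dots> \<le> ennreal E * Lnorm r (einterval 0 L) (\<lambda>u. ennreal (u powr (- rcp r)) * ?h' u)"
      using einterval_0_subset[of L] Bnorm_measurable[OF b averaging_op_measurable[OF W d A gm]]
      by (intro E(2) bound) auto
    also have "Lnorm r (einterval 0 L) (\<lambda>u. ennreal (u powr (- rcp r)) * ?h' u)
        = Lnorm r (einterval 0 L) (\<lambda>u. ennreal (K * C * D) * (ennreal (u powr (rcp p - rcp r) * b u) * g u))"
    proof (rule Lnorm_cong[OF r])
      fix u assume u: "u \<in> einterval 0 L"
      have "ennreal (u powr (- rcp r)) * ennreal (?w u) = ennreal (u powr (rcp p - rcp r) * b u)"
      proof -
        have "u powr (- rcp r) * ?w u = u powr (rcp p - rcp r) * b u"
          by (simp add: powr_diff powr_minus divide_inverse)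
        then show ?thesis
          using slowly_varying_pos[OF b u] by (simp flip: ennreal_mult)
      qed
      then have "ennreal (u powr (- rcp r)) * ?h u = ennreal (u powr (rcp p - rcp r) * b u) * g u"
        by (simp flip: mult.assoc)
      then show "ennreal (u powr (- rcp r)) * ?h' u = ennreal (K * C * D) * (ennreal (u powr (rcp p - rcp r) * b u) * g u)"
        by (simp only: mult.left_commute[of "ennreal (u powr (- rcp r))"])
    qed
    also have "\<dots> \<le> ennreal (K * C * D) * Bnorm L p r b g"
      unfolding Bnorm_def by (intro Lnorm_cmult_le r Bnorm_measurable b gm)
    finally show "Bnorm L p r b (averaging_op A a W d g) \<le> ennreal (E * (K * C * D)) * Bnorm L p r b g"
      using K C D E by (simp add: ennreal_mult mult.assoc mult_left_mono)
  qed
qed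

text \<open>Both estimates hold for all non-increasing functions with fixed constants, so the
  average as a functional of the rearrangement meets the abstract criterion.\<close>

lemma Bnorm_averaging_op_equiv_ri_quasinorm:
  assumes L: "L \<in> {1, \<infinity>}" and r: "0 < r" and W: "0 < W"
    and b: "b \<in> slowly_varying L" and d: "d \<in> slowly_varying L" and nontriv: "LK_nontrivial L p r b"
    and \<eta>: "0 < \<eta>" and A: "averaging_family L A (rcp p - a) \<eta>"
  shows "sim_on (meas_fun L) (LKnorm L p r b) (\<lambda>f. Bnorm L p r b (averaging_op A a W d (rearr L f)))"
    and "equiv_ri_quasinorm L p r b (\<lambda>f. Bnorm L p r b (averaging_op A a W d (rearr L f)))"
proof -
  obtain C1 where C1: "0 < C1" "\<And>g. antimono_on (einterval 0 L) g \<Longrightarrow> Bnorm L p r b g \<le> ennreal C1 * Bnorm L p r b (averaging_op A a W d g)"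
    using Bnorm_le_Bnorm_averaging_op[OF r W b d A] by blast
  obtain C2 where C2: "0 < C2" "\<And>g. antimono_on (einterval 0 L) g \<Longrightarrow> Bnorm L p r b (averaging_op A a W d g) \<le> ennreal C2 * Bnorm L p r b g"
    using Bnorm_averaging_op_le_Bnorm[OF r W b d \<eta> A] by blast
  have cmult: "Bnorm L p r b (averaging_op A a W d (\<lambda>t. ennreal c * g t)) = ennreal c * Bnorm L p r b (averaging_op A a W d g)"
    if "antimono_on (einterval 0 L) g" "0 < c" for g c
  proof -
    have g: "g \<in> borel_measurable (lebesgue_on (einterval 0 L))" by (rule measurable_antimono_on[OF that(1)])
    have "Bnorm L p r b (averaging_op A a W d (\<lambda>t. ennreal c * g t)) = Bnorm L p r b (\<lambda>t. ennreal c * averaging_op A a W d g t)"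
      by (intro Bnorm_cong r averaging_op_cmult[OF W d A] g that)
    also have "\<dots> = ennreal c * Bnorm L p r b (averaging_op A a W d g)"
      by (intro Bnorm_cmult r b averaging_op_measurable[OF W d A] g that)
    finally show ?thesis .
  qed
  have mono: "Bnorm L p r b (averaging_op A a W d g) \<le> Bnorm L p r b (averaging_op A a W d h)"
    if "antimono_on (einterval 0 L) g" "\<And>t. t \<in> einterval 0 L \<Longrightarrow> g t \<le> h t" for g h
    using that by (intro Bnorm_mono r b averaging_op_measurable[OF W d A] averaging_op_mono[OF W d A] measurable_antimono_on)
  have SUP: "Bnorm L p r b (averaging_op A a W d (\<lambda>t. SUP n. g n t)) = (SUP n. Bnorm L p r b (averaging_op A a W d (g n)))"
    if g: "\<And>n::nat. antimono_on (einterval 0 L) (g n)" and inc: "\<And>t. t \<in> einterval 0 L \<Longrightarrow> incseq (\<lambda>n. g n t)" for g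
  proof -
    have gm: "g n \<in> borel_measurable (lebesgue_on (einterval 0 L))" for n by (rule measurable_antimono_on[OF g])
    have "Bnorm L p r b (averaging_op A a W d (\<lambda>t. SUP n. g n t)) = Bnorm L p r b (\<lambda>t. SUP n. averaging_op A a W d (g n) t)"
      by (intro Bnorm_cong r averaging_op_SUP[OF W d A] gm inc)
    also have "\<dots> = (SUP n. Bnorm L p r b (averaging_op A a W d (g n)))"
    proof (intro Bnorm_SUP r b averaging_op_measurable[OF W d A] gm)
      fix t assume t: "t \<in> einterval 0 L"
      show "incseq (\<lambda>n. averaging_op A a W d (g n) t)"
        using inc by (intro incseq_SucI averaging_op_mono[OF W d A gm _ t]) (auto simp: incseq_Suc_iff)
    qed
    finally show ?thesis .
  qed
  note equiv = equiv_ri_quasinorm_rearr[where \<Phi> = "\<lambda>g. Bnorm L p r b (averaging_op A a W d g)",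
      OF L r b nontriv cmult mono SUP C1(1) C1(2) C2(1) C2(2)]
  show "sim_on (meas_fun L) (LKnorm L p r b) (\<lambda>f. Bnorm L p r b (averaging_op A a W d (rearr L f)))"
    by (rule equiv(1)) blast+
  show "equiv_ri_quasinorm L p r b (\<lambda>f. Bnorm L p r b (averaging_op A a W d (rearr L f)))"
    by (rule equiv(2)) blast+
qed

theorem theorem34:
  fixes L p r U V W :: ereal and b d :: "real \<Rightarrow> real"
  assumes "L \<in> {1, \<infinity>}"
    and "0 < p" and "0 < r"
    and "b \<in> slowly_varying L"
    and "LK_nontrivial L p r b"
    and "d \<in> slowly_varying L"
    and "0 < U" and "U < \<infinity>" and "0 < V" and "0 < W"
  shows
    "(U < p \<longrightarrow>
        sim_on (meas_fun L) (LKnorm L p r b) (\<lambda>f. Bnorm L p r b (avg_head L U W d f)) \<and>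
        equiv_ri_quasinorm L p r b (\<lambda>f. Bnorm L p r b (avg_head L U W d f))) \<and>
     (p < V \<longrightarrow>
        sim_on (meas_fun L) (LKnorm L p r b) (\<lambda>f. Bnorm L p r b (avg_tail L V W d f)) \<and>
        equiv_ri_quasinorm L p r b (\<lambda>f. Bnorm L p r b (avg_tail L V W d f)))"
proof (intro conjI impI)
  assume "U < p"
  have pos: "0 < rcp U - rcp p" using rcp_less[OF assms(7) \<open>U < p\<close>] by simp
  have head: "averaging_family L (\<lambda>t. einterval 0 (ereal t)) (rcp p - rcp U) (rcp U - rcp p)"
    unfolding averaging_family_def
  proof (intro conjI allI ballI impI)
    show "mono_on (einterval 0 L) (\<lambda>t. einterval 0 (ereal t)) \<or> antimono_on (einterval 0 L) (\<lambda>t. einterval 0 (ereal t))"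
      by (intro disjI1) (auto simp: monotone_on_def einterval_iff)
    fix t assume t: "t \<in> einterval 0 L"
    show "einterval 0 (ereal t) \<subseteq> einterval 0 L"
    proof
      fix x assume "x \<in> einterval 0 (ereal t)"
      then show "x \<in> einterval 0 L"
        using einterval_0_down[OF t, of x] by (simp add: einterval_iff)
    qed
    show "{t/2<..<t} \<subseteq> einterval 0 (ereal t) \<or> {t<..<2 * t} \<subseteq> einterval 0 (ereal t)"
      using t by (intro disjI1) (auto simp: einterval_iff)
    fix v assume v: "v \<in> einterval 0 (ereal t)"
    have "0 < v" "v < t" "0 < t" using t v by (auto simp: einterval_iff)
    then have "v / t \<le> 1" "1 \<le> t / v" by auto
    then have "min (t / v) (v / t) = v / t" by simp
    \<comment> \<open>The decay condition holds with equality: for \<open>v < t\<close> the kernel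
      is a power of \<open>v / t\<close> with exponent opposite to
      \<open>rcp p - rcp U\<close>.\<close>
    then show "t powr (rcp p - rcp U) \<le> ratio_kernel (rcp U - rcp p) t v * v powr (rcp p - rcp U)"
      using \<open>0 < v\<close> \<open>0 < t\<close> powr_minus[of t "rcp U - rcp p"] powr_minus[of v "rcp U - rcp p"]
      by (simp add: ratio_kernel_def powr_divide inverse_eq_divide)
  qed simp
  show "sim_on (meas_fun L) (LKnorm L p r b) (\<lambda>f. Bnorm L p r b (avg_head L U W d f))"
    and "equiv_ri_quasinorm L p r b (\<lambda>f. Bnorm L p r b (avg_head L U W d f))"
    unfolding avg_head_eq by (rule Bnorm_averaging_op_equiv_ri_quasinorm[OF assms(1,3,10,4,6,5) pos head])+
next
  assume "p < V"
  have pos: "0 < rcp p - rcp V" using rcp_less[OF assms(2) \<open>p < V\<close>] by simp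
  have tail: "averaging_family L (\<lambda>t. einterval (ereal t) L) (rcp p - rcp V) (rcp p - rcp V)"
    unfolding averaging_family_def
  proof (intro conjI allI ballI impI)
    show "mono_on (einterval 0 L) (\<lambda>t. einterval (ereal t) L) \<or> antimono_on (einterval 0 L) (\<lambda>t. einterval (ereal t) L)"
      by (intro disjI2) (auto simp: monotone_on_def einterval_iff)
    fix t assume t: "t \<in> einterval 0 L"
    show "einterval (ereal t) L \<subseteq> einterval 0 L"
      using t by (auto simp: einterval_iff)
    \<comment> \<open>The premise on \<open>2 * t\<close> ensures that \<open>(t, 2 t)\<close> ends
      below \<open>L\<close>, which could fail for \<open>L = 1\<close> and \<open>t\<close> above
      \<open>1 / 2\<close>.\<close>
    show "{t/2<..<t} \<subseteq> einterval (ereal t) L \<or> {t<..<2 * t} \<subseteq> einterval (ereal t) L"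
      if "2 * t \<in> einterval 0 L"
    proof (intro disjI2 subsetI)
      fix x assume "x \<in> {t<..<2 * t}"
      then show "x \<in> einterval (ereal t) L"
        using einterval_0_down[OF that, of x] t by (auto simp: einterval_iff)
    qed
    fix v assume v: "v \<in> einterval (ereal t) L"
    have "0 < t" "t < v" "0 < v" using t v by (auto simp: einterval_iff)
    then have "t / v \<le> 1" "1 \<le> v / t" by auto
    then have "min (t / v) (v / t) = t / v" by simp
    \<comment> \<open>Equality again, now with the exponent \<open>rcp p - rcp V\<close> itself, as
      \<open>v\<close> lies to the right of \<open>t\<close> and the kernel is a power of
      \<open>t / v\<close>.\<close>
    then show "t powr (rcp p - rcp V) \<le> ratio_kernel (rcp p - rcp V) t v * v powr (rcp p - rcp V)"
      using \<open>0 < v\<close> \<open>0 < t\<close> by (simp add: ratio_kernel_def powr_divide)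
  qed simp
  show "sim_on (meas_fun L) (LKnorm L p r b) (\<lambda>f. Bnorm L p r b (avg_tail L V W d f))"
    and "equiv_ri_quasinorm L p r b (\<lambda>f. Bnorm L p r b (avg_tail L V W d f))"
    unfolding avg_tail_eq by (rule Bnorm_averaging_op_equiv_ri_quasinorm[OF assms(1,3,10,4,6,5) pos tail])+
qed

end
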